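(* In type $E_6^{(2)}$ the map $\phi: y_v\mapsto v$ defines an isomorphism of classical crystals $C\xrightarrow{\sim}B$ from the crystal $C$ of equivalence classes of Young columns to the level $1$ perfect crystal $B$ of $U_q(E_6^{(2)})$. In type $F_4^{(1)}$ the map $\phi: y_v\mapsto v$ defines an isomorphism of classical crystals $C'\xrightarrow{\sim}B'$ from the crystal $C'$ of equivalence classes of Young columns to the level $1$ perfect crystal $B'$ of $U_q(F_4^{(1)})$.
   Context: **Cartan data.** $I=\{0,1,2,3,4\}$, $a_{ij}=\langle h_i,\alpha_j\rangle$, $a_{ii}=2$; the nonzero off-diagonal entries are: for $E_6^{(2)}$, $a_{01}=a_{10}=a_{12}=a_{21}=-1$, $a_{23}=-2$, $a_{32}=-1$, $a_{34}=a_{43}=-1$; for $F_4^{(1)}$, $a_{01}=a_{10}=a_{12}=a_{21}=-1$, $a_{23}=-1$, $a_{32}=-2$, $a_{34}=a_{43}=-1$. $P$ is the affine weight lattice, $\delta$ the null root, $\Lambda_i$ the fundamental weights, $\overline P=\bigoplus_{i\in I}\mathbb Z\Lambda_i$ the classical weight lattice ($P$ modulo $\delta$; $\alpha_i\mapsto\sum_j a_{ji}\Lambda_j$). An affine (resp. classical) crystal is a Kashiwara crystal with weights in $P$ (resp. $\overline P$): maps $\mathrm{wt},\tilde e_i,\tilde f_i,\varepsilon_i,\varphi_i$ with the usual axioms. An isomorphism of crystals is a bijection (with $0\mapsto 0$) commuting with all structure maps. **Perfect crystals.** Write $(a_1a_2a_3a_4)=\sum a_i\alpha_i$ and $\overline{(a_1a_2a_3a_4)}=-\sum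 a_i\alpha_i$. Type $E_6^{(2)}$: $\Phi^+=\{(1000),(0100),(1100),(0110),(1110),(0111),(1111),(1210),(1211),(1221),(1321),(2321)\}$, $\theta=(2321)$, and $B=\{x_{\pm\alpha}:\alpha\in\Phi^+\}\cup\{r_1,r_2\}\cup\{\emptyset\}$. Type $F_4^{(1)}$: $\Phi^+=\{(1000),(0100),(0010),(0001),(1100),(0110),(0011),(1110),(0120),(0111),(1120),(1111),(0121),(1220),(1121),(0122),(1221),(1122),(1231),(1222),(1232),(1242),(1342),(2342)\}$, $\theta=(2342)$, and $B'=\{x_{\pm\alpha}:\alpha\in\Phi^+\}\cup\{r_1,r_2,r_3,r_4\}\cup\{\emptyset\}$. The element $x_\alpha$ is also written simply $\alpha$. With $\Phi^-=-\Phi^+$, the arrows ($b\xrightarrow{i}b'$ means $\tilde f_ib=b'$) are: for $i\ne0$, $x_\alpha\xrightarrow{i}x_\beta$ iff $\alpha-\alpha_i=\beta$ ($\alpha,\beta\in\Phi^+\cup\Phi^-$), and $x_{\alpha_i}\xrightarrow{i}r_i\xrightarrow{i}x_{-\alpha_i}$ when $\alpha_i\in\Phi^+$; for $i=0$, $x_\alpha\xrightarrow{0}x_\beta$ iff $\alpha+\theta=\beta$ ($\alpha,\beta\in\Phi^+\cup\Phi^-$, $\alpha,\beta\ne\pm\theta$), and $x_{-\theta}\xrightarrow{0}\emptyset\xrightarrow{0}x_\theta$. $\mathrm{wt}(x_\alpha)=\alpha$, $\mathrm{wt}(r_i)=\mathrm{wt}(\emptyset)=0$ (in $\overline P$), and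 $\varepsilon_i,\varphi_i$ are string lengths: $\varepsilon_i(b)=\max\{n:\tilde e_i^nb\ne0\}$, $\varphi_i(b)=\max\{n:\tilde f_i^nb\neq0\}$. **Young column patterns.** A pattern is an infinite vertical stack of colored blocks arranged in rows indexed by $\mathbb Z$ from bottom to top. It is invariant under the shift by four rows combined with the $180^\circ$ rotation around the vertical axis; this symmetry $\sigma$ sends a block with index $m$ to the block with the same letter and index $m+1$. "$x$ on $y$" means block $x$ rests on block $y$ (so $y$ must be present for there to be no empty space below $x$); $i$-block means a block of color $i$. *Type $E_6^{(2)}$*, for every $m\in\mathbb Z$: row $4m$: $c_m$ (color 3), $a_m$ (color 1); row $4m+1$: $b_m,b'_m$ (color 2); row $4m+2$: $a'_m$ (color 1), $c'_m$ (color 3); row $4m+3$: $z_m$ (color 0), $b''_m$ (color 2), $d_m$ (color 4). Support: $b_m$ on $c_m$; $b'_m$ on $c_m,a_m$; $a'_m$ on $b_m$; $c'_m$ on $b_m,b'_m$; $z_m$ on $a'_m$; $b''_m$ on $a'_m,c'_m$; $d_m$ on $c'_m$; $a_{m+1}$ on $z_m,b''_m$; $c_{m+1}$ on $b''_m,d_m$. *Type $F_4^{(1)}$*, for every $m\in\mathbb Z$: row $4m$: $c^1_m$ (color 3), $d^1_m$ (color 4), $a^1_m$ (color 1); row $4m+1$: $c^2_m$ (color 3), $b^1_m$ (color 2); row $4m+2$: $b^2_m$ (color 2), $c^3_m$ (color 3); row $4m+3$ (a double-height row): $a^2_m$ (color 1), $c^4_m$ (color 3), $d^2_m$ (color 4),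 $z_m$ (color 0), $b^3_m$ (color 2). Support: $c^2_m$ on $c^1_m,d^1_m$; $b^1_m$ on $c^1_m,a^1_m$; $b^2_m$ on $c^2_m$; $c^3_m$ on $b^1_m$; $a^2_m$ on $b^2_m$; $c^4_m$ on $b^2_m,c^3_m$; $d^2_m$ on $c^3_m$; $z_m$ on $a^2_m$; $b^3_m$ on $a^2_m,c^4_m$; $c^1_{m+1}$ on $b^3_m,c^4_m,d^2_m$; $d^1_{m+1}$ on $c^4_m,d^2_m$; $a^1_{m+1}$ on $z_m,b^3_m$. **Young columns.** A pre-Young column is a nonempty set of blocks of the pattern whose height is bounded above and which contains, with any block, all blocks it rests on. A block of it is free if removing it leaves a pre-Young column. A pre-Young column is exceptional if its highest nonempty row contains precisely one free $2$-block and the column contains a free $1$-block (up to $\sigma$ the only one is: all blocks of index $\le0$ together with $a_1,c_1,b_1$ in type $E_6^{(2)}$, and with $c^1_1,d^1_1,a^1_1,c^2_1,b^2_1$ in type $F_4^{(1)}$). A Young column is a non-exceptional pre-Young column. Two Young columns are equivalent if they are related by vertical shift and $180^\circ$ rotation, i.e. by a power of $\sigma$. **Labels $y_v$ of the equivalence classes.** *Type $E_6^{(2)}$.* Let $D$ be the set of all blocks of index $\le-1$ and $c_0,a_0,b_0,b'_0,a'_0,c'_0,b''_0$. Put $C_1=\{d_0,c_1\}$, $C_2=C_1\cup\{b_1\}$, $C_3=C_2\cup\{a'_1\}$, $C_4=C_3\cup\{z_1\}$. The class of $D\cup S$ has the label: $S=\emptyset$: $\overline{(1210)}$; $\{d_0\}$: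 $\overline{(1211)}$; $\{z_0\}$: $(1111)$; $\{z_0,d_0\}$: $(1110)$; $\{z_0,a_1\}$: $(0111)$; $\{z_0,a_1,d_0\}$: $(0110)$. For $S=C_1,C_2,C_3,C_4$: $\overline{(1221)},\overline{(1321)},\overline{(2321)},\emptyset$. For $S=\{z_0\}\cup C_j$, $j=1,\dots,4$: $(1100),(1000),r_1,(2321)$. For $S=\{z_0,a_1\}\cup C_j$, $j=1,3,4$: $(0100),\overline{(1000)},(1321)$. For $S=\{z_0,a_1,b'_1\}\cup C_j$, $j=1,\dots,4$: $r_2,\overline{(0100)},\overline{(1100)},(1221)$. For $S=\{z_0,a_1,b'_1,c'_1\}\cup C_j$, $j=2,3,4$: $\overline{(0110)},\overline{(1110)},(1211)$. For $S=\{z_0,a_1,b'_1,c'_1,d_1\}\cup C_j$, $j=2,3,4$: $\overline{(0111)},\overline{(1111)},(1210)$. *Type $F_4^{(1)}$.* Let $D$ be the set of all blocks of index $\le -1$ and all blocks of index $0$ except $z_0,d^2_0$. Put $L_0=\emptyset$, $L_1=\{z_0\}$, $L_2=L_1\cup\{a^1_1\}$, $L_3=L_2\cup\{b^1_1\}$, $L_4=L_3\cup\{c^3_1\}$, $L_5=L_4\cup\{d^2_1\}$; $R_0=\emptyset$, $R_1=\{d^2_0\}$, $R_2=\{d^2_0,d^1_1\}$; $Q_1=\{d^2_0,c^1_1\}$, $Q_2=Q_1\cup\{d^1_1\}$, $Q_3=Q_2\cup\{c^2_1\}$, $Q_4=Q_3\cup\{b^2_1\}$, $Q_5=Q_4\cup\{a^2_1\}$,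 $Q_6=Q_5\cup\{z_1\}$. The class of $D\cup S$ has the label: for $S=L_0\cup R_j$ ($j=0,1,2$): $\overline{(1220)},\overline{(1221)},\overline{(1222)}$; $L_1\cup R_j$: $(1122),(1121),(1120)$; $L_2\cup R_j$: $(0122),(0121),(0120)$. For $S=L_s\cup Q_j$ ($j=1,\dots,6$): $s=0$: $\overline{(1231)},\overline{(1232)},\overline{(1242)},\overline{(1342)},\overline{(2342)},\emptyset$; $s=1$: $(1111),(1110),(1100),(1000),r_1,(2342)$; $s=2$ ($j\neq4$): $(0111),(0110),(0100),\overline{(1000)},(1342)$ for $j=1,2,3,5,6$; $s=3$: $(0011),(0010),r_2,\overline{(0100)},\overline{(1100)},(1242)$; $s=4$: $(0001),r_3,\overline{(0010)},\overline{(0110)},\overline{(1110)},(1232)$; $s=5$: $r_4,\overline{(0001)},\overline{(0011)},\overline{(0111)},\overline{(1111)},(1231)$. For $j=4,5,6$: $S=L_4\cup Q_j\cup\{c^4_1\}$: $\overline{(0120)},\overline{(1120)},(1222)$; $S=L_5\cup Q_j\cup\{c^4_1\}$: $\overline{(0121)},\overline{(1121)},(1221)$; $S=L_5\cup Q_j\cup\{c^4_1,d^1_2\}$: $\overline{(0122)},\overline{(1122)},(1220)$. **Crystal structure on Young columns.** An $i$-block in a Young column $y$ is removable if removing it gives a Young column; an $i$-block of the pattern not in $y$ is addable if adding it gives a Young column. $\tilde f_i$ adds an addable $i$-block if one exists (the higher one if there are two), and is $0$ otherwise; moreover $\tilde f_i(y)=0$ whenever $y\in y_{r_j}$ with $j\ne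 i$. $\tilde e_i$ removes a removable $i$-block if one exists (the lower one if there are two), and is $0$ otherwise; moreover $\tilde e_i(y)=0$ whenever $y\in y_{r_j}$ with $j\neq i$. $\varphi_i(y)=\max\{n:\tilde f_i^ny\ne0\}$, $\varepsilon_i(y)=\max\{n:\tilde e_i^ny\neq0\}$. The weight is fixed to be $\mathrm{wt}(y)=\Lambda_0$ for some Young column $y$ in the class $y_\emptyset$ and extended to all Young columns by $\mathrm{wt}(\tilde f_iy)=\mathrm{wt}(y)-\alpha_i$ if $\tilde f_iy\neq0$ and $\mathrm{wt}(\tilde e_iy)=\mathrm{wt}(y)+\alpha_i$ if $\tilde e_iy\neq0$. Projecting weights to $\overline P$, this descends to a classical crystal structure on the set of equivalence classes of Young columns, denoted $C$ in type $E_6^{(2)}$ and $C'$ in type $F_4^{(1)}$.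
   Formalization: The weight on Young columns is normalised to be 0 (not Λ_0) on the class y_∅, since with Λ_0 the map cannot preserve weights (wt(∅)=0 in B and B'); with Λ_0 it is shown that all classical weights are shifted by exactly Λ_0. *)

theory Defs
  imports Main "HOL-Library.Function_Algebras" "HOL-Library.Product_Plus"
begin

section \<open>Cartan data and weights\<close>

text \<open>The index set is \<open>{..4}\<close>.\<close>

datatype aff_type = E62 | F41

fun cartan :: "aff_type \<Rightarrow> nat \<Rightarrow> nat \<Rightarrow> int" where
  "cartan T i j =
    (if i = j then 2
     else if (i, j) \<in> {(0,1), (1,0), (1,2), (2,1), (3,4), (4,3)} then -1
     else if (i, j) = (2, 3) then (case T of E62 \<Rightarrow> -2 | F41 \<Rightarrow> -1)
     else if (i, j) = (3, 2) then (case T of E62 \<Rightarrow> -1 | F41 \<Rightarrow> -2)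
     else 0)"

text \<open>
  A classical weight is its vector of coordinates with respect to the fundamental weights, so that
  \<open>\<nu> i\<close> is the pairing of \<open>\<nu>\<close> with the coroot \<open>h\<^sub>i\<close>; the coordinates outside the index set vanish.
  An affine weight has the coefficient of \<open>\<delta>\<close> as a further component, and \<^const>\<open>fst\<close> is the
  projection modulo \<open>\<delta>\<close>.
\<close>

type_synonym weight = "nat \<Rightarrow> int"
type_synonym aff_weight = "weight \<times> int"

definition classical_weights :: "weight set" where
  "classical_weights = {\<nu>. \<forall>i>4. \<nu> i = 0}"

definition fund_weight :: "nat \<Rightarrow> aff_weight" where
  "fund_weight i = ((\<lambda>j. if j = i then 1 else 0), 0)"

text \<open>
  In both types \<open>\<alpha>\<^sub>0\<close> has coefficient 1 in \<open>\<delta>\<close>, which is why \<open>\<delta>\<close> enters \<open>\<alpha>\<^sub>0\<close> only, and with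
  coefficient 1.
\<close>

definition simple_root :: "aff_type \<Rightarrow> nat \<Rightarrow> aff_weight" where
  "simple_root T i = ((\<lambda>j. if j \<le> 4 then cartan T j i else 0), if i = 0 then 1 else 0)"


section \<open>Classical crystals\<close>

text \<open>
  The element 0 adjoined to a crystal is rendered as \<^const>\<open>None\<close>.  The value \<open>-\<infinity>\<close> for
  \<open>\<epsilon>\<^sub>i\<close> and \<open>\<phi>\<^sub>i\<close> is left out: here these functions are string lengths.
\<close>

record 'b crystal =
  elems :: "'b set"
  wt :: "'b \<Rightarrow> weight"
  e_op :: "nat \<Rightarrow> 'b \<Rightarrow> 'b option"
  f_op :: "nat \<Rightarrow> 'b \<Rightarrow> 'b option"
  eps :: "nat \<Rightarrow> 'b \<Rightarrow> int"
  phi :: "nat \<Rightarrow> 'b \<Rightarrow> int"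

definition classical_crystal :: "aff_type \<Rightarrow> 'b crystal \<Rightarrow> bool" where
  "classical_crystal T X \<longleftrightarrow>
    (\<forall>b \<in> elems X. wt X b \<in> classical_weights) \<and>
    (\<forall>i \<le> 4. \<forall>b \<in> elems X.
      phi X i b = eps X i b + wt X b i \<and>
      (\<forall>b'. e_op X i b = Some b' \<longrightarrow>
         b' \<in> elems X \<and> wt X b' = wt X b + fst (simple_root T i) \<and>
         eps X i b' = eps X i b - 1 \<and> phi X i b' = phi X i b + 1) \<and>
      (\<forall>b'. f_op X i b = Some b' \<longrightarrow>
         b' \<in> elems X \<and> wt X b' = wt X b - fst (simple_root T i) \<and>
         eps X i b' = eps X i b + 1 \<and> phi X i b' = phi X i b - 1) \<and>
      (\<forall>b' \<in> elems X. f_op X i b = Some b' \<longleftrightarrow> e_op X i b' = Some b))"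

definition classical_crystal_iso ::
    "aff_type \<Rightarrow> 'a crystal \<Rightarrow> 'b crystal \<Rightarrow> ('a \<Rightarrow> 'b) \<Rightarrow> bool" where
  "classical_crystal_iso T X Y h \<longleftrightarrow>
    classical_crystal T X \<and> classical_crystal T Y \<and>
    bij_betw h (elems X) (elems Y) \<and>
    (\<forall>b \<in> elems X. wt Y (h b) = wt X b) \<and>
    (\<forall>i \<le> 4. \<forall>b \<in> elems X.
      e_op Y i (h b) = map_option h (e_op X i b) \<and>
      f_op Y i (h b) = map_option h (f_op X i b) \<and>
      eps Y i (h b) = eps X i b \<and>
      phi Y i (h b) = phi X i b)"

definition string_length :: "('b \<Rightarrow> 'b option) \<Rightarrow> 'b \<Rightarrow> nat" where
  "string_length g b = Max {n. ((\<lambda>x. Option.bind x g) ^^ n) (Some b) \<noteq> None}"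


section \<open>The perfect crystals\<close>

text \<open>\<open>X (a\<^sub>1, a\<^sub>2, a\<^sub>3, a\<^sub>4)\<close> is the element indexed by the root \<open>a\<^sub>1 \<alpha>\<^sub>1 + \<dots> + a\<^sub>4 \<alpha>\<^sub>4\<close>.\<close>

type_synonym root = "int \<times> int \<times> int \<times> int"

datatype vertex = X root | R nat | Emp

abbreviation pos :: "int \<Rightarrow> int \<Rightarrow> int \<Rightarrow> int \<Rightarrow> vertex" where
  "pos a b c d \<equiv> X (a, b, c, d)"

abbreviation neg :: "int \<Rightarrow> int \<Rightarrow> int \<Rightarrow> int \<Rightarrow> vertex" where
  "neg a b c d \<equiv> X (- a, - b, - c, - d)"

definition simple :: "nat \<Rightarrow> root" where
  "simple i = (of_bool (i = 1), of_bool (i = 2), of_bool (i = 3), of_bool (i = 4))"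

fun pos_roots :: "aff_type \<Rightarrow> root set" where
  "pos_roots E62 =
      {(1,0,0,0), (0,1,0,0), (1,1,0,0), (0,1,1,0), (1,1,1,0), (0,1,1,1),
       (1,1,1,1), (1,2,1,0), (1,2,1,1), (1,2,2,1), (1,3,2,1), (2,3,2,1)}"
| "pos_roots F41 =
      {(1,0,0,0), (0,1,0,0), (0,0,1,0), (0,0,0,1), (1,1,0,0), (0,1,1,0),
       (0,0,1,1), (1,1,1,0), (0,1,2,0), (0,1,1,1), (1,1,2,0), (1,1,1,1),
       (0,1,2,1), (1,2,2,0), (1,1,2,1), (0,1,2,2), (1,2,2,1), (1,1,2,2),
       (1,2,3,1), (1,2,2,2), (1,2,3,2), (1,2,4,2), (1,3,4,2), (2,3,4,2)}"

fun theta :: "aff_type \<Rightarrow> root" where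
  "theta E62 = (2,3,2,1)"
| "theta F41 = (2,3,4,2)"

definition roots :: "aff_type \<Rightarrow> root set" where
  "roots T = pos_roots T \<union> uminus ` pos_roots T"

inductive arrow :: "aff_type \<Rightarrow> nat \<Rightarrow> vertex \<Rightarrow> vertex \<Rightarrow> bool" for T where
  root_i: "\<lbrakk>i \<in> {1..4}; \<alpha> \<in> roots T; \<beta> \<in> roots T; \<alpha> - simple i = \<beta>\<rbrakk> \<Longrightarrow> arrow T i (X \<alpha>) (X \<beta>)"
| to_r: "\<lbrakk>i \<in> {1..4}; simple i \<in> pos_roots T\<rbrakk> \<Longrightarrow> arrow T i (X (simple i)) (R i)"
| from_r: "\<lbrakk>i \<in> {1..4}; simple i \<in> pos_roots T\<rbrakk> \<Longrightarrow> arrow T i (R i) (X (- simple i))"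
| root_0: "\<lbrakk>\<alpha> \<in> roots T; \<beta> \<in> roots T; \<alpha> \<notin> {theta T, - theta T}; \<beta> \<notin> {theta T, - theta T};
     \<alpha> + theta T = \<beta>\<rbrakk> \<Longrightarrow> arrow T 0 (X \<alpha>) (X \<beta>)"
| to_emp: "arrow T 0 (X (- theta T)) Emp"
| from_emp: "arrow T 0 Emp (X (theta T))"

fun vertex_wt :: "aff_type \<Rightarrow> vertex \<Rightarrow> weight" where
  "vertex_wt T (X (a, b, c, d)) =
     (\<lambda>j. a * fst (simple_root T 1) j + b * fst (simple_root T 2) j
        + c * fst (simple_root T 3) j + d * fst (simple_root T 4) j)"
| "vertex_wt T (R i) = 0"
| "vertex_wt T Emp = 0"

definition B_f :: "aff_type \<Rightarrow> nat \<Rightarrow> vertex \<Rightarrow> vertex option" where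
  "B_f T i b = (if \<exists>b'. arrow T i b b' then Some (THE b'. arrow T i b b') else None)"

definition B_e :: "aff_type \<Rightarrow> nat \<Rightarrow> vertex \<Rightarrow> vertex option" where
  "B_e T i b = (if \<exists>b'. arrow T i b' b then Some (THE b'. arrow T i b' b) else None)"

definition perfect_crystal :: "aff_type \<Rightarrow> vertex crystal" where
  "perfect_crystal T = \<lparr>
     elems = X ` roots T \<union> R ` (case T of E62 \<Rightarrow> {1, 2} | F41 \<Rightarrow> {1, 2, 3, 4}) \<union> {Emp},
     wt = vertex_wt T,
     e_op = B_e T,
     f_op = B_f T,
     eps = (\<lambda>i b. int (string_length (B_e T i) b)),
     phi = (\<lambda>i b. int (string_length (B_f T i) b))\<rparr>"


section \<open>Young columns\<close>

text \<open>
  A block is a letter together with its index \<open>m\<close>.  The block \<open>(l, m)\<close> lies in row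
  \<open>4 * m + row_of pt l\<close> and rests on the blocks \<open>(l', m + k)\<close> with \<open>(l', k) \<in> support pt l\<close>.
  The field \<open>labels\<close> consists of the pairs \<open>(v, Y)\<close> such that the equivalence class of the
  column \<open>Y\<close> is \<open>y\<^sub>v\<close>.
\<close>

type_synonym 'l block = "'l \<times> int"

record 'l pattern =
  colour_of :: "'l \<Rightarrow> nat"
  row_of :: "'l \<Rightarrow> int"
  support :: "'l \<Rightarrow> 'l block set"
  labels :: "(vertex \<times> 'l block set) set"

definition colour :: "('l, 'm) pattern_scheme \<Rightarrow> 'l block \<Rightarrow> nat" where
  "colour pt b = colour_of pt (fst b)"

definition row :: "('l, 'm) pattern_scheme \<Rightarrow> 'l block \<Rightarrow> int" where
  "row pt b = 4 * snd b + row_of pt (fst b)"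

definition rests_on :: "('l, 'm) pattern_scheme \<Rightarrow> 'l block \<Rightarrow> 'l block set" where
  "rests_on pt b = {(l, snd b + k) | l k. (l, k) \<in> support pt (fst b)}"

definition pre_young :: "('l, 'm) pattern_scheme \<Rightarrow> 'l block set \<Rightarrow> bool" where
  "pre_young pt Y \<longleftrightarrow>
     Y \<noteq> {} \<and> (\<exists>N. \<forall>b \<in> Y. row pt b \<le> N) \<and> (\<forall>b \<in> Y. rests_on pt b \<subseteq> Y)"

definition free_block :: "('l, 'm) pattern_scheme \<Rightarrow> 'l block set \<Rightarrow> 'l block \<Rightarrow> bool" where
  "free_block pt Y b \<longleftrightarrow> b \<in> Y \<and> pre_young pt (Y - {b})"

definition exceptional :: "('l, 'm) pattern_scheme \<Rightarrow> 'l block set \<Rightarrow> bool" where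
  "exceptional pt Y \<longleftrightarrow>
     pre_young pt Y \<and>
     (\<exists>!b. free_block pt Y b \<and> colour pt b = 2 \<and> (\<forall>b' \<in> Y. row pt b' \<le> row pt b)) \<and>
     (\<exists>b. free_block pt Y b \<and> colour pt b = 1)"

definition young_columns :: "('l, 'm) pattern_scheme \<Rightarrow> 'l block set set" where
  "young_columns pt = {Y. pre_young pt Y \<and> \<not> exceptional pt Y}"

definition shift :: "int \<Rightarrow> 'l block set \<Rightarrow> 'l block set" where
  "shift k Y = (\<lambda>(l, m). (l, m + k)) ` Y"

definition column_rel :: "('l, 'm) pattern_scheme \<Rightarrow> ('l block set \<times> 'l block set) set" where
  "column_rel pt =
     {(Y, Y'). Y \<in> young_columns pt \<and> Y' \<in> young_columns pt \<and> (\<exists>k. Y' = shift k Y)}"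

definition labelled_class :: "('l, 'm) pattern_scheme \<Rightarrow> vertex \<Rightarrow> 'l block set set" where
  "labelled_class pt v = {Y'. \<exists>Y. (v, Y) \<in> labels pt \<and> (Y, Y') \<in> column_rel pt}"


section \<open>The crystal of equivalence classes of Young columns\<close>

definition addable :: "('l, 'm) pattern_scheme \<Rightarrow> nat \<Rightarrow> 'l block set \<Rightarrow> 'l block set" where
  "addable pt i Y = {b. b \<notin> Y \<and> colour pt b = i \<and> insert b Y \<in> young_columns pt}"

definition removable :: "('l, 'm) pattern_scheme \<Rightarrow> nat \<Rightarrow> 'l block set \<Rightarrow> 'l block set" where
  "removable pt i Y = {b. b \<in> Y \<and> colour pt b = i \<and> Y - {b} \<in> young_columns pt}"

definition col_f :: "('l, 'm) pattern_scheme \<Rightarrow> nat \<Rightarrow> 'l block set \<Rightarrow> 'l block set option" where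
  "col_f pt i Y =
     (if (\<exists>j. j \<noteq> i \<and> Y \<in> labelled_class pt (R j)) \<or> addable pt i Y = {} then None
      else Some (insert (arg_max_on (row pt) (addable pt i Y)) Y))"

definition col_e :: "('l, 'm) pattern_scheme \<Rightarrow> nat \<Rightarrow> 'l block set \<Rightarrow> 'l block set option" where
  "col_e pt i Y =
     (if (\<exists>j. j \<noteq> i \<and> Y \<in> labelled_class pt (R j)) \<or> removable pt i Y = {} then None
      else Some (Y - {arg_min_on (row pt) (removable pt i Y)}))"

text \<open>
  \<open>has_wt T pt Y\<^sub>0 \<mu> Y \<nu>\<close>: the weight \<open>\<nu>\<close> of \<open>Y\<close> is obtained by extending, along the operators,
  the normalisation that \<open>Y\<^sub>0\<close> has weight \<open>\<mu>\<close>.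
\<close>

inductive has_wt :: "aff_type \<Rightarrow> ('l, 'm) pattern_scheme \<Rightarrow> 'l block set \<Rightarrow> aff_weight
    \<Rightarrow> 'l block set \<Rightarrow> aff_weight \<Rightarrow> bool"
  for T pt Y\<^sub>0 \<mu> where
  base: "has_wt T pt Y\<^sub>0 \<mu> Y\<^sub>0 \<mu>"
| f_step: "\<lbrakk>has_wt T pt Y\<^sub>0 \<mu> Y \<nu>; i \<le> 4; col_f pt i Y = Some Y'\<rbrakk>
     \<Longrightarrow> has_wt T pt Y\<^sub>0 \<mu> Y' (\<nu> - simple_root T i)"
| e_step: "\<lbrakk>has_wt T pt Y\<^sub>0 \<mu> Y \<nu>; i \<le> 4; col_e pt i Y = Some Y'\<rbrakk>
     \<Longrightarrow> has_wt T pt Y\<^sub>0 \<mu> Y' (\<nu> + simple_root T i)"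

definition col_wt :: "aff_type \<Rightarrow> ('l, 'm) pattern_scheme \<Rightarrow> 'l block set \<Rightarrow> aff_weight
    \<Rightarrow> 'l block set \<Rightarrow> aff_weight" where
  "col_wt T pt Y\<^sub>0 \<mu> Y = (THE \<nu>. has_wt T pt Y\<^sub>0 \<mu> Y \<nu>)"

text \<open>
  The value on a class of a function on columns that is constant on the class; unspecified
  for functions that do not descend.
\<close>

definition descend :: "('y \<Rightarrow> 'c) \<Rightarrow> 'y set \<Rightarrow> 'c" where
  "descend g c = the_elem (g ` c)"

text \<open>
  The perfect crystals have level 0, so that \<open>Y\<^sub>0\<close> in the class \<open>y\<^sub>\<emptyset>\<close> must be given a weight \<open>\<mu>\<close>
  with classical projection 0: there \<open>\<phi>\<^sub>0 = \<epsilon>\<^sub>0 = 1\<close>.  With \<open>\<mu> = \<Lambda>\<^sub>0\<close> all weights are shifted by \<open>\<Lambda>\<^sub>0\<close>, and the axiom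
  \<open>\<phi>\<^sub>0 = \<epsilon>\<^sub>0 + \<langle>h\<^sub>0, wt\<rangle>\<close> fails.
\<close>

definition column_crystal :: "aff_type \<Rightarrow> ('l, 'm) pattern_scheme \<Rightarrow> 'l block set \<Rightarrow> aff_weight
    \<Rightarrow> 'l block set set crystal" where
  "column_crystal T pt Y\<^sub>0 \<mu> = \<lparr>
     elems = young_columns pt // column_rel pt,
     wt = descend (\<lambda>Y. fst (col_wt T pt Y\<^sub>0 \<mu> Y)),
     e_op = (\<lambda>i. descend (\<lambda>Y. map_option (\<lambda>Y'. column_rel pt `` {Y'}) (col_e pt i Y))),
     f_op = (\<lambda>i. descend (\<lambda>Y. map_option (\<lambda>Y'. column_rel pt `` {Y'}) (col_f pt i Y))),
     eps = (\<lambda>i. descend (\<lambda>Y. int (string_length (col_e pt i) Y))),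
     phi = (\<lambda>i. descend (\<lambda>Y. int (string_length (col_f pt i) Y)))\<rparr>"

definition label_map :: "('l, 'm) pattern_scheme \<Rightarrow> 'l block set set \<Rightarrow> vertex" where
  "label_map pt c = (THE v. labelled_class pt v = c)"


section \<open>The pattern of type \<open>E\<^sub>6\<^sup>(\<^sup>2\<^sup>)\<close>\<close>

datatype e_letter = Ea | Ea' | Eb | Eb' | Eb'' | Ec | Ec' | Ed | Ez

fun E_colour :: "e_letter \<Rightarrow> nat" where
  "E_colour Ec = 3" | "E_colour Ea = 1"
| "E_colour Eb = 2" | "E_colour Eb' = 2"
| "E_colour Ea' = 1" | "E_colour Ec' = 3"
| "E_colour Ez = 0" | "E_colour Eb'' = 2" | "E_colour Ed = 4"

fun E_row :: "e_letter \<Rightarrow> int" where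
  "E_row Ec = 0" | "E_row Ea = 0"
| "E_row Eb = 1" | "E_row Eb' = 1"
| "E_row Ea' = 2" | "E_row Ec' = 2"
| "E_row Ez = 3" | "E_row Eb'' = 3" | "E_row Ed = 3"

fun E_support :: "e_letter \<Rightarrow> e_letter block set" where
  "E_support Eb = {(Ec, 0)}"
| "E_support Eb' = {(Ec, 0), (Ea, 0)}"
| "E_support Ea' = {(Eb, 0)}"
| "E_support Ec' = {(Eb, 0), (Eb', 0)}"
| "E_support Ez = {(Ea', 0)}"
| "E_support Eb'' = {(Ea', 0), (Ec', 0)}"
| "E_support Ed = {(Ec', 0)}"
| "E_support Ea = {(Ez, -1), (Eb'', -1)}"
| "E_support Ec = {(Eb'', -1), (Ed, -1)}"

definition E_D :: "e_letter block set" where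
  "E_D = {(l, m). m \<le> -1} \<union>
         {(Ec,0), (Ea,0), (Eb,0), (Eb',0), (Ea',0), (Ec',0), (Eb'',0)}"

definition E_C :: "nat \<Rightarrow> e_letter block set" where
  "E_C j = {(Ed,0), (Ec,1)} \<union> (if j \<ge> 2 then {(Eb,1)} else {})
         \<union> (if j \<ge> 3 then {(Ea',1)} else {}) \<union> (if j \<ge> 4 then {(Ez,1)} else {})"

definition E_table :: "(vertex \<times> e_letter block set) set" where
  "E_table = {
    (neg 1 2 1 0, {}),
    (neg 1 2 1 1, {(Ed,0)}),
    (pos 1 1 1 1, {(Ez,0)}),
    (pos 1 1 1 0, {(Ez,0),(Ed,0)}),
    (pos 0 1 1 1, {(Ez,0),(Ea,1)}),
    (pos 0 1 1 0, {(Ez,0),(Ea,1),(Ed,0)}),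
    (neg 1 2 2 1, E_C 1),
    (neg 1 3 2 1, E_C 2),
    (neg 2 3 2 1, E_C 3),
    (Emp, E_C 4),
    (pos 1 1 0 0, {(Ez,0)} \<union> E_C 1),
    (pos 1 0 0 0, {(Ez,0)} \<union> E_C 2),
    (R 1, {(Ez,0)} \<union> E_C 3),
    (pos 2 3 2 1, {(Ez,0)} \<union> E_C 4),
    (pos 0 1 0 0, {(Ez,0),(Ea,1)} \<union> E_C 1),
    (neg 1 0 0 0, {(Ez,0),(Ea,1)} \<union> E_C 3),
    (pos 1 3 2 1, {(Ez,0),(Ea,1)} \<union> E_C 4),
    (R 2, {(Ez,0),(Ea,1),(Eb',1)} \<union> E_C 1),
    (neg 0 1 0 0, {(Ez,0),(Ea,1),(Eb',1)} \<union> E_C 2),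
    (neg 1 1 0 0, {(Ez,0),(Ea,1),(Eb',1)} \<union> E_C 3),
    (pos 1 2 2 1, {(Ez,0),(Ea,1),(Eb',1)} \<union> E_C 4),
    (neg 0 1 1 0, {(Ez,0),(Ea,1),(Eb',1),(Ec',1)} \<union> E_C 2),
    (neg 1 1 1 0, {(Ez,0),(Ea,1),(Eb',1),(Ec',1)} \<union> E_C 3),
    (pos 1 2 1 1, {(Ez,0),(Ea,1),(Eb',1),(Ec',1)} \<union> E_C 4),
    (neg 0 1 1 1, {(Ez,0),(Ea,1),(Eb',1),(Ec',1),(Ed,1)} \<union> E_C 2),
    (neg 1 1 1 1, {(Ez,0),(Ea,1),(Eb',1),(Ec',1),(Ed,1)} \<union> E_C 3),
    (pos 1 2 1 0, {(Ez,0),(Ea,1),(Eb',1),(Ec',1),(Ed,1)} \<union> E_C 4)}"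

definition E_pattern :: "e_letter pattern" where
  "E_pattern = \<lparr>colour_of = E_colour, row_of = E_row, support = E_support,
     labels = {(v, E_D \<union> S) | v S. (v, S) \<in> E_table}\<rparr>"


section \<open>The pattern of type \<open>F\<^sub>4\<^sup>(\<^sup>1\<^sup>)\<close>\<close>

datatype f_letter = Fa1 | Fa2 | Fb1 | Fb2 | Fb3 | Fc1 | Fc2 | Fc3 | Fc4 | Fd1 | Fd2 | Fz

fun F_colour :: "f_letter \<Rightarrow> nat" where
  "F_colour Fc1 = 3" | "F_colour Fd1 = 4" | "F_colour Fa1 = 1"
| "F_colour Fc2 = 3" | "F_colour Fb1 = 2"
| "F_colour Fb2 = 2" | "F_colour Fc3 = 3"
| "F_colour Fa2 = 1" | "F_colour Fc4 = 3" | "F_colour Fd2 = 4" | "F_colour Fz = 0"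
| "F_colour Fb3 = 2"

fun F_row :: "f_letter \<Rightarrow> int" where
  "F_row Fc1 = 0" | "F_row Fd1 = 0" | "F_row Fa1 = 0"
| "F_row Fc2 = 1" | "F_row Fb1 = 1"
| "F_row Fb2 = 2" | "F_row Fc3 = 2"
| "F_row Fa2 = 3" | "F_row Fc4 = 3" | "F_row Fd2 = 3" | "F_row Fz = 3" | "F_row Fb3 = 3"

fun F_support :: "f_letter \<Rightarrow> f_letter block set" where
  "F_support Fc2 = {(Fc1, 0), (Fd1, 0)}"
| "F_support Fb1 = {(Fc1, 0), (Fa1, 0)}"
| "F_support Fb2 = {(Fc2, 0)}"
| "F_support Fc3 = {(Fb1, 0)}"
| "F_support Fa2 = {(Fb2, 0)}"
| "F_support Fc4 = {(Fb2, 0), (Fc3, 0)}"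
| "F_support Fd2 = {(Fc3, 0)}"
| "F_support Fz = {(Fa2, 0)}"
| "F_support Fb3 = {(Fa2, 0), (Fc4, 0)}"
| "F_support Fc1 = {(Fb3, -1), (Fc4, -1), (Fd2, -1)}"
| "F_support Fd1 = {(Fc4, -1), (Fd2, -1)}"
| "F_support Fa1 = {(Fz, -1), (Fb3, -1)}"

definition F_D :: "f_letter block set" where
  "F_D = {(l, m). m \<le> -1} \<union> ({(l, m). m = 0} - {(Fz,0), (Fd2,0)})"

definition F_L :: "nat \<Rightarrow> f_letter block set" where
  "F_L s = (if s \<ge> 1 then {(Fz,0)} else {}) \<union> (if s \<ge> 2 then {(Fa1,1)} else {})
         \<union> (if s \<ge> 3 then {(Fb1,1)} else {}) \<union> (if s \<ge> 4 then {(Fc3,1)} else {})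
         \<union> (if s \<ge> 5 then {(Fd2,1)} else {})"

definition F_R :: "nat \<Rightarrow> f_letter block set" where
  "F_R j = (if j \<ge> 1 then {(Fd2,0)} else {}) \<union> (if j \<ge> 2 then {(Fd1,1)} else {})"

definition F_Q :: "nat \<Rightarrow> f_letter block set" where
  "F_Q j = {(Fd2,0), (Fc1,1)} \<union> (if j \<ge> 2 then {(Fd1,1)} else {})
         \<union> (if j \<ge> 3 then {(Fc2,1)} else {}) \<union> (if j \<ge> 4 then {(Fb2,1)} else {})
         \<union> (if j \<ge> 5 then {(Fa2,1)} else {}) \<union> (if j \<ge> 6 then {(Fz,1)} else {})"

definition F_table :: "(vertex \<times> f_letter block set) set" where
  "F_table = {
    (neg 1 2 2 0, F_L 0 \<union> F_R 0),
    (neg 1 2 2 1, F_L 0 \<union> F_R 1),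
    (neg 1 2 2 2, F_L 0 \<union> F_R 2),
    (pos 1 1 2 2, F_L 1 \<union> F_R 0),
    (pos 1 1 2 1, F_L 1 \<union> F_R 1),
    (pos 1 1 2 0, F_L 1 \<union> F_R 2),
    (pos 0 1 2 2, F_L 2 \<union> F_R 0),
    (pos 0 1 2 1, F_L 2 \<union> F_R 1),
    (pos 0 1 2 0, F_L 2 \<union> F_R 2),
    (neg 1 2 3 1, F_L 0 \<union> F_Q 1),
    (neg 1 2 3 2, F_L 0 \<union> F_Q 2),
    (neg 1 2 4 2, F_L 0 \<union> F_Q 3),
    (neg 1 3 4 2, F_L 0 \<union> F_Q 4),
    (neg 2 3 4 2, F_L 0 \<union> F_Q 5),
    (Emp, F_L 0 \<union> F_Q 6),
    (pos 1 1 1 1, F_L 1 \<union> F_Q 1),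
    (pos 1 1 1 0, F_L 1 \<union> F_Q 2),
    (pos 1 1 0 0, F_L 1 \<union> F_Q 3),
    (pos 1 0 0 0, F_L 1 \<union> F_Q 4),
    (R 1, F_L 1 \<union> F_Q 5),
    (pos 2 3 4 2, F_L 1 \<union> F_Q 6),
    (pos 0 1 1 1, F_L 2 \<union> F_Q 1),
    (pos 0 1 1 0, F_L 2 \<union> F_Q 2),
    (pos 0 1 0 0, F_L 2 \<union> F_Q 3),
    (neg 1 0 0 0, F_L 2 \<union> F_Q 5),
    (pos 1 3 4 2, F_L 2 \<union> F_Q 6),
    (pos 0 0 1 1, F_L 3 \<union> F_Q 1),
    (pos 0 0 1 0, F_L 3 \<union> F_Q 2),
    (R 2, F_L 3 \<union> F_Q 3),
    (neg 0 1 0 0, F_L 3 \<union> F_Q 4),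
    (neg 1 1 0 0, F_L 3 \<union> F_Q 5),
    (pos 1 2 4 2, F_L 3 \<union> F_Q 6),
    (pos 0 0 0 1, F_L 4 \<union> F_Q 1),
    (R 3, F_L 4 \<union> F_Q 2),
    (neg 0 0 1 0, F_L 4 \<union> F_Q 3),
    (neg 0 1 1 0, F_L 4 \<union> F_Q 4),
    (neg 1 1 1 0, F_L 4 \<union> F_Q 5),
    (pos 1 2 3 2, F_L 4 \<union> F_Q 6),
    (R 4, F_L 5 \<union> F_Q 1),
    (neg 0 0 0 1, F_L 5 \<union> F_Q 2),
    (neg 0 0 1 1, F_L 5 \<union> F_Q 3),
    (neg 0 1 1 1, F_L 5 \<union> F_Q 4),
    (neg 1 1 1 1, F_L 5 \<union> F_Q 5),
    (pos 1 2 3 1, F_L 5 \<union> F_Q 6),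
    (neg 0 1 2 0, F_L 4 \<union> F_Q 4 \<union> {(Fc4,1)}),
    (neg 1 1 2 0, F_L 4 \<union> F_Q 5 \<union> {(Fc4,1)}),
    (pos 1 2 2 2, F_L 4 \<union> F_Q 6 \<union> {(Fc4,1)}),
    (neg 0 1 2 1, F_L 5 \<union> F_Q 4 \<union> {(Fc4,1)}),
    (neg 1 1 2 1, F_L 5 \<union> F_Q 5 \<union> {(Fc4,1)}),
    (pos 1 2 2 1, F_L 5 \<union> F_Q 6 \<union> {(Fc4,1)}),
    (neg 0 1 2 2, F_L 5 \<union> F_Q 4 \<union> {(Fc4,1),(Fd1,2)}),
    (neg 1 1 2 2, F_L 5 \<union> F_Q 5 \<union> {(Fc4,1),(Fd1,2)}),
    (pos 1 2 2 0, F_L 5 \<union> F_Q 6 \<union> {(Fc4,1),(Fd1,2)})}"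

definition F_pattern :: "f_letter pattern" where
  "F_pattern = \<lparr>colour_of = F_colour, row_of = F_row, support = F_support,
     labels = {(v, F_D \<union> S) | v S. (v, S) \<in> F_table}\<rparr>"

end

theory Submission
  imports Defs
begin

text \<open>Both sides are finite once columns are taken modulo shift, so the theorem becomes a
  finite comparison as soon as the infinite columns are under control. A block of index
  \<open>m\<close> forces all blocks of index at most \<open>m - 2\<close> (\<open>E_deep\<close>,
  \<open>F_deep\<close>, \<open>deep_below\<close>). Hence a pre-Young column has a largest index up
  to which it is full, and once this index is shifted to -1 the column is determined by its blocks
  of index 0 and 1 (\<open>window_determines\<close>). These are order ideals in a finite poset.
  Enumerating them yields nothing beyond the tabulated columns and one exceptional column, and no
  two tabulated columns are shifts of each other. So \<open>col v k\<close> parametrises all Young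
  columns bijectively (\<open>young_col\<close>, \<open>col_inj\<close>), and classes correspond to
  labels.

  Being free, exceptional, addable or removable is reduced to a test on finite lists in the locale
  \<open>column_layout\<close>. The operators on columns are then compared with the arrows of the
  perfect crystal by evaluation (\<open>col_f_col\<close>, \<open>col_e_col\<close>).

  Weights are defined by extension from one column, so both consistency and reachability have to be
  shown. The weight of \<open>col v k\<close> should be the weight of \<open>v\<close>, with a
  coefficient of \<delta> that counts 0-blocks; this is compatible with every step
  (\<open>has_wt_unique\<close>). Every column is reached because every vertex is connected to
  \<open>Emp\<close>, and because closed walks with two and with three 0-arrows combine to a shift
  by one (\<open>weighted_col\<close>). The normalising weight enters only as an additive constant:
  classical part 0 gives the isomorphism, and the fundamental weight of index 0 translates all
  weights by itself.

  The crystal axioms are checked for the perfect crystal alone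
  (\<open>classical_crystal_perfect\<close>) and pulled back along the label map
  (\<open>classical_crystal_iso_transport\<close>).\<close>

section \<open>String lengths\<close>

lemma string_length_eqI:
  assumes "((\<lambda>x. Option.bind x g) ^^ n) (Some b) \<noteq> None"
    and "((\<lambda>x. Option.bind x g) ^^ Suc n) (Some b) = None"
  shows "string_length g b = n"
proof -
  let ?it = "\<lambda>m. ((\<lambda>x. Option.bind x g) ^^ m) (Some b)"
  have none: "?it (Suc n + m) = None" for m
    using assms(2) by (induction m) auto
  have "m \<le> n" if "?it m \<noteq> None" for m
    using none[of "m - Suc n"] that by (cases "m \<le> n") auto
  moreover have "?it m \<noteq> None" if "m \<le> n" for m
  proof
    assume "?it m = None"
    then have "?it (m + d) = None" for d by (induction d) auto
    from this[of "n - m"] assms(1) that show False by auto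
  qed
  ultimately have "{m. ?it m \<noteq> None} = {..n}" by auto
  moreover have "Max {..n} = n" by (rule Max_eqI) auto
  ultimately show ?thesis by (simp add: string_length_def)
qed

text \<open>The length of a string only depends on which iterates are \<open>None\<close>, so
  \<open>h\<close> may forget information. It is applied to the map from columns to vertices that
  forgets the shift.\<close>

lemma string_length_conj:
  assumes g: "\<And>b. b \<in> A \<Longrightarrow> g' (h b) = map_option h (g b)"
    and A: "\<And>b b'. b \<in> A \<Longrightarrow> g b = Some b' \<Longrightarrow> b' \<in> A" and "b \<in> A"
  shows "string_length g' (h b) = string_length g b"
proof -
  have "((\<lambda>x. Option.bind x g') ^^ n) (Some (h b)) = map_option h (((\<lambda>x. Option.bind x g) ^^ n) (Some b)) \<and>
        (\<forall>b'. ((\<lambda>x. Option.bind x g) ^^ n) (Some b) = Some b' \<longrightarrow> b' \<in> A)" for n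
  proof (induction n)
    case (Suc n)
    then show ?case
      by (cases "((\<lambda>x. Option.bind x g) ^^ n) (Some b)") (auto simp: g intro: A)
  qed (use \<open>b \<in> A\<close> in auto)
  then show ?thesis by (simp add: string_length_def)
qed

section \<open>The perfect crystals in executable form, and their axioms\<close>

fun pos_list :: "aff_type \<Rightarrow> root list" where
  "pos_list E62 =
      [(1,0,0,0), (0,1,0,0), (1,1,0,0), (0,1,1,0), (1,1,1,0), (0,1,1,1),
       (1,1,1,1), (1,2,1,0), (1,2,1,1), (1,2,2,1), (1,3,2,1), (2,3,2,1)]"
| "pos_list F41 =
      [(1,0,0,0), (0,1,0,0), (0,0,1,0), (0,0,0,1), (1,1,0,0), (0,1,1,0),
       (0,0,1,1), (1,1,1,0), (0,1,2,0), (0,1,1,1), (1,1,2,0), (1,1,1,1),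
       (0,1,2,1), (1,2,2,0), (1,1,2,1), (0,1,2,2), (1,2,2,1), (1,1,2,2),
       (1,2,3,1), (1,2,2,2), (1,2,3,2), (1,2,4,2), (1,3,4,2), (2,3,4,2)]"

definition root_test :: "aff_type \<Rightarrow> root \<Rightarrow> bool" where
  "root_test T \<alpha> \<longleftrightarrow> \<alpha> \<in> set (pos_list T) \<or> - \<alpha> \<in> set (pos_list T)"

definition simple_test :: "aff_type \<Rightarrow> nat \<Rightarrow> bool" where
  "simple_test T i \<longleftrightarrow> i = 1 \<or> i = 2 \<or> T = F41 \<and> (i = 3 \<or> i = 4)"

fun next_f :: "aff_type \<Rightarrow> nat \<Rightarrow> vertex \<Rightarrow> vertex option" where
  "next_f T i (X \<alpha>) =
     (if i = 0 then
        if \<alpha> = - theta T then Some Emp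
        else if root_test T (\<alpha> + theta T) \<and> root_test T \<alpha> then Some (X (\<alpha> + theta T)) else None
      else if \<alpha> = simple i \<and> simple_test T i then Some (R i)
      else if root_test T (\<alpha> - simple i) \<and> root_test T \<alpha> then Some (X (\<alpha> - simple i)) else None)"
| "next_f T i (R j) = (if i = j \<and> simple_test T i then Some (X (- simple i)) else None)"
| "next_f T i Emp = (if i = 0 then Some (X (theta T)) else None)"

fun next_e :: "aff_type \<Rightarrow> nat \<Rightarrow> vertex \<Rightarrow> vertex option" where
  "next_e T i (X \<alpha>) =
     (if i = 0 then
        if \<alpha> = theta T then Some Emp
        else if root_test T (\<alpha> - theta T) \<and> root_test T \<alpha> then Some (X (\<alpha> - theta T)) else None
      else if \<alpha> = - simple i \<and> simple_test T i then Some (R i)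
      else if root_test T (\<alpha> + simple i) \<and> root_test T \<alpha> then Some (X (\<alpha> + simple i)) else None)"
| "next_e T i (R j) = (if i = j \<and> simple_test T i then Some (X (simple i)) else None)"
| "next_e T i Emp = (if i = 0 then Some (X (- theta T)) else None)"

text \<open>The numeral is fuel; the result \<open>None\<close> means that it ran out before the
  string ended.\<close>

fun steps :: "('b \<Rightarrow> 'b option) \<Rightarrow> nat \<Rightarrow> 'b \<Rightarrow> nat option" where
  "steps g 0 b = None"
| "steps g (Suc n) b = (case g b of None \<Rightarrow> Some 0 | Some b' \<Rightarrow> map_option Suc (steps g n b'))"

text \<open>Fuel 4 certifies strings of length at most 3. The changes of the string lengths along an
  arrow are not tested, as \<open>steps_Suc\<close> derives them from the arrows being mutually
  inverse.\<close>

definition crystal_at :: "aff_type \<Rightarrow> vertex list \<Rightarrow> nat \<Rightarrow> vertex \<Rightarrow> bool" where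
  "crystal_at T V i v \<longleftrightarrow>
     (case next_f T i v of None \<Rightarrow> True | Some u \<Rightarrow> u \<in> set V \<and> next_e T i u = Some v \<and>
        (\<forall>j\<in>set [0..<5]. vertex_wt T u j = vertex_wt T v j - cartan T j i)) \<and>
     (case next_e T i v of None \<Rightarrow> True | Some u \<Rightarrow> u \<in> set V \<and> next_f T i u = Some v) \<and>
     (case (steps (next_f T i) 4 v, steps (next_e T i) 4 v) of
        (Some p, Some e) \<Rightarrow> int p = int e + vertex_wt T v i | _ \<Rightarrow> False)"

lemma steps_iter:
  "steps g n b = Some k \<Longrightarrow> ((\<lambda>x. Option.bind x g) ^^ k) (Some b) \<noteq> None \<and>
     ((\<lambda>x. Option.bind x g) ^^ Suc k) (Some b) = None"
proof (induction g n b arbitrary: k rule: steps.induct)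
  case (2 g n b)
  then show ?case
    by (auto split: option.splits simp: funpow_Suc_right simp del: funpow.simps(2)) 
qed simp

lemma string_length_steps: "steps g n b = Some k \<Longrightarrow> string_length g b = k"
  using steps_iter string_length_eqI by metis

lemma steps_Suc: "steps g n b = Some k \<Longrightarrow> g b = Some b' \<Longrightarrow> steps g n' b' = Some k' \<Longrightarrow> k = Suc k'"
  using steps_iter[of g n b k] steps_iter[of g n' b' k'] string_length_eqI[of k' g b'] string_length_eqI[of "k - 1" g b']
  by (cases k) (auto simp: funpow_Suc_right simp del: funpow.simps(2))

lemma set_pos_list: "set (pos_list T) = pos_roots T"
  by (cases T) simp_all

lemma root_test_iff: "root_test T \<alpha> \<longleftrightarrow> \<alpha> \<in> roots T"
proof -
  have "\<alpha> \<in> uminus ` A \<longleftrightarrow> - \<alpha> \<in> A" for A :: "root set"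
    by (metis (no_types) add.inverse_inverse image_iff)
  then show ?thesis by (simp add: root_test_def roots_def set_pos_list)
qed

lemma simple_test_iff: "i \<in> {1..4} \<Longrightarrow> simple_test T i \<longleftrightarrow> simple i \<in> pos_roots T"
  by (cases T) (auto simp: simple_test_def simple_def numeral_eq_Suc elim!: le_SucE)

lemma simple_testD: "simple_test T i \<Longrightarrow> i \<in> {1..4} \<and> simple i \<in> pos_roots T"
proof -
  assume *: "simple_test T i"
  then have "i \<in> {1..4}" by (auto simp: simple_test_def)
  with * simple_test_iff show ?thesis by blast
qed

text \<open>These facts ensure that a 0-arrow between two roots never starts or ends at
  \<open>theta T\<close> or its negative, which are joined through \<open>Emp\<close> instead; and
  that subtracting \<open>simple i\<close> from itself does not stay among the roots.\<close>

lemma theta_sums: "theta T + theta T \<notin> roots T" "- theta T - theta T \<notin> roots T" "0 \<notin> roots T"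
  by (cases T; simp add: root_test_iff[symmetric] root_test_def zero_prod_def)+

lemma arrow_next_f:
  assumes "i \<le> 4" shows "arrow T i b b' \<longleftrightarrow> next_f T i b = Some b'"
proof
  assume "arrow T i b b'"
  then show "next_f T i b = Some b'"
  proof cases
    case (root_i \<alpha> \<beta>)
    then have "\<alpha> \<noteq> simple i" using theta_sums(3)[of T] by auto
    with root_i show ?thesis by (simp add: root_test_iff)
  next
    case (root_0 \<alpha> \<beta>)
    then show ?thesis by (simp add: root_test_iff)
  qed (simp_all add: simple_test_iff)
next
  assume "next_f T i b = Some b'"
  then show "arrow T i b b'"
  proof (cases b)
    case (X \<alpha>)
    have "\<alpha> + theta T \<noteq> theta T" "\<alpha> \<noteq> theta T" "\<alpha> + theta T \<noteq> - theta T" if "\<alpha> \<in> roots T" "\<alpha> + theta T \<in> roots T"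
      using that theta_sums[of T] by (auto simp: eq_diff_eq[symmetric])
    with X \<open>next_f T i b = Some b'\<close> assms simple_testD[of T i] show ?thesis
      using arrow.intros(1)[of i \<alpha> T "\<alpha> - simple i"] arrow.intros(2)[of i T] arrow.intros(4)[of \<alpha> T "\<alpha> + theta T"] arrow.intros(5)[of T]
      by (simp add: root_test_iff split: if_splits)
  next
    case (R j)
    with \<open>next_f T i b = Some b'\<close> simple_testD[of T i] arrow.from_r[of i T] show ?thesis
      by (simp split: if_splits)
  next
    case Emp
    with \<open>next_f T i b = Some b'\<close> arrow.from_emp[of T] show ?thesis
      by (simp split: if_splits)
  qed
qed

lemma arrow_next_e:
  assumes "i \<le> 4" shows "arrow T i b' b \<longleftrightarrow> next_e T i b = Some b'"
proof
  assume "arrow T i b' b"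
  then show "next_e T i b = Some b'"
  proof cases
    case (root_i \<alpha> \<beta>)
    then have "\<alpha> = \<beta> + simple i" "\<beta> \<noteq> - simple i" using theta_sums(3)[of T] by auto
    with root_i show ?thesis by (simp add: root_test_iff)
  next
    case (root_0 \<alpha> \<beta>)
    then have "\<alpha> = \<beta> - theta T" by auto
    with root_0 show ?thesis by (simp add: root_test_iff)
  qed (simp_all add: simple_test_iff)
next
  assume "next_e T i b = Some b'"
  then show "arrow T i b' b"
  proof (cases b)
    case (X \<alpha>)
    have "\<alpha> - theta T \<noteq> theta T" "\<alpha> \<noteq> - theta T" "\<alpha> - theta T \<noteq> - theta T" if "\<alpha> \<in> roots T" "\<alpha> - theta T \<in> roots T"
      using that theta_sums[of T] by (auto simp: diff_eq_eq)
    with X \<open>next_e T i b = Some b'\<close> assms simple_testD[of T i] show ?thesis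
      using arrow.intros(1)[of i "\<alpha> + simple i" T \<alpha>] arrow.intros(3)[of i T] arrow.intros(4)[of "\<alpha> - theta T" T \<alpha>] arrow.intros(6)[of T]
      by (simp add: root_test_iff split: if_splits)
  next
    case (R j)
    with \<open>next_e T i b = Some b'\<close> simple_testD[of T i] arrow.to_r[of i T] show ?thesis
      by (simp split: if_splits)
  next
    case Emp
    with \<open>next_e T i b = Some b'\<close> arrow.to_emp[of T] show ?thesis
      by (simp split: if_splits)
  qed
qed

lemma B_f_next_f: "i \<le> 4 \<Longrightarrow> B_f T i = next_f T i"
  by (rule ext, case_tac "next_f T i x") (auto simp: B_f_def arrow_next_f)

lemma B_e_next_e: "i \<le> 4 \<Longrightarrow> B_e T i = next_e T i"
  by (rule ext, case_tac "next_e T i x") (auto simp: B_e_def arrow_next_e)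

lemma vertex_wt_classical: "vertex_wt T v \<in> classical_weights"
  by (cases "(T, v)" rule: vertex_wt.cases) (auto simp: classical_weights_def simple_root_def)

lemma classical_crystal_perfect:
  assumes V: "elems (perfect_crystal T) = set V"
    and ok: "\<forall>i\<in>set [0..<5]. \<forall>v\<in>set V. crystal_at T V i v"
  shows "classical_crystal T (perfect_crystal T)"
proof -
  have ok': "crystal_at T V i v" if "i \<le> 4" "v \<in> set V" for i v
    using ok that by auto
  have wt: "vertex_wt T u = vertex_wt T v - fst (simple_root T i)"
    if "i \<le> 4" "v \<in> set V" "next_f T i v = Some u" for i v u
  proof
    fix j
    show "vertex_wt T u j = (vertex_wt T v - fst (simple_root T i)) j"
    proof (cases "j \<le> 4")
      case True
      with ok'[OF that(1,2)] that(3) show ?thesis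
        by (auto simp: crystal_at_def simple_root_def simp del: cartan.simps)
    next
      case False
      with vertex_wt_classical[of T u] vertex_wt_classical[of T v] show ?thesis
        by (auto simp: classical_weights_def simple_root_def)
    qed
  qed
  have inv: "next_e T i u = Some v \<longleftrightarrow> next_f T i v = Some u" if "i \<le> 4" for i u v
    using arrow_next_f[OF that] arrow_next_e[OF that] by metis
  have mem: "u \<in> set V" if "i \<le> 4" "v \<in> set V" "next_f T i v = Some u \<or> next_e T i v = Some u" for i u v
    using ok'[OF that(1,2)] that(3) by (auto simp: crystal_at_def)
  have st: "\<exists>p e. steps (next_f T i) 4 v = Some p \<and> steps (next_e T i) 4 v = Some e \<and> int p = int e + vertex_wt T v i"
    if "i \<le> 4" "v \<in> set V" for i v
    using ok'[OF that] by (auto simp: crystal_at_def split: option.splits)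
  have str: "string_length (next_f T i) u = string_length (next_f T i) v - 1 \<and> string_length (next_f T i) v > 0 \<and>
     string_length (next_e T i) u = Suc (string_length (next_e T i) v)"
    if uv: "i \<le> 4" "v \<in> set V" "next_f T i v = Some u" for i u v
  proof -
    obtain p e where 1: "steps (next_f T i) 4 v = Some p" "steps (next_e T i) 4 v = Some e"
      using st uv(1,2) by blast
    obtain p' e' where 2: "steps (next_f T i) 4 u = Some p'" "steps (next_e T i) 4 u = Some e'"
      using st mem uv by blast
    show ?thesis
      using steps_Suc[OF 1(1) uv(3) 2(1)] steps_Suc[OF 2(2) _ 1(2)] inv uv
        string_length_steps[OF 1(1)] string_length_steps[OF 1(2)]
        string_length_steps[OF 2(1)] string_length_steps[OF 2(2)] by simp
  qed
  show ?thesis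
    unfolding classical_crystal_def V
  proof (intro conjI allI ballI impI)
    fix v and i :: nat
    assume i: "i \<le> 4" and v: "v \<in> set V"
    show "phi (perfect_crystal T) i v = eps (perfect_crystal T) i v + wt (perfect_crystal T) v i"
      using st[OF i v] by (auto simp: perfect_crystal_def B_f_next_f B_e_next_e i string_length_steps)
    fix u
    show "e_op (perfect_crystal T) i v = Some u \<Longrightarrow> u \<in> set V"
      using mem[OF i v] by (auto simp: perfect_crystal_def B_f_next_f B_e_next_e i)
    show "f_op (perfect_crystal T) i v = Some u \<Longrightarrow> u \<in> set V"
      using mem[OF i v] by (auto simp: perfect_crystal_def B_f_next_f B_e_next_e i)
    show "e_op (perfect_crystal T) i v = Some u \<Longrightarrow> wt (perfect_crystal T) u = wt (perfect_crystal T) v + fst (simple_root T i)"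
      "e_op (perfect_crystal T) i v = Some u \<Longrightarrow> eps (perfect_crystal T) i u = eps (perfect_crystal T) i v - 1"
      "e_op (perfect_crystal T) i v = Some u \<Longrightarrow> phi (perfect_crystal T) i u = phi (perfect_crystal T) i v + 1"
      using mem[OF i v, of u] str[OF i, of u v] wt[OF i, of u v] inv[OF i, of v u]
      by (auto simp: perfect_crystal_def B_f_next_f B_e_next_e i)
    show "f_op (perfect_crystal T) i v = Some u \<Longrightarrow> wt (perfect_crystal T) u = wt (perfect_crystal T) v - fst (simple_root T i)"
      "f_op (perfect_crystal T) i v = Some u \<Longrightarrow> eps (perfect_crystal T) i u = eps (perfect_crystal T) i v + 1"
      "f_op (perfect_crystal T) i v = Some u \<Longrightarrow> phi (perfect_crystal T) i u = phi (perfect_crystal T) i v - 1"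
      using v mem[OF i v, of u] str[OF i, of v u] wt[OF i, of v u]
      by (auto simp: perfect_crystal_def B_f_next_f B_e_next_e i)
    show "(f_op (perfect_crystal T) i v = Some u) = (e_op (perfect_crystal T) i u = Some v)"
      by (simp add: perfect_crystal_def B_f_next_f B_e_next_e i inv)
  qed (simp_all add: perfect_crystal_def vertex_wt_classical)
qed

text \<open>The structure maps of \<open>C\<close> are those of \<open>D\<close> read through the
  bijection \<open>h\<close>, so the axioms in \<open>D\<close> give those in \<open>C\<close>.
  Closure of \<open>C\<close> under its operators is a separate assumption because \<open>h\<close>
  is injective only on \<open>elems C\<close>.\<close>

lemma classical_crystal_iso_transport:
  assumes D: "classical_crystal T D" and bij: "bij_betw h (elems C) (elems D)"
    and wt: "\<And>b. b \<in> elems C \<Longrightarrow> wt D (h b) = wt C b"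
    and e: "\<And>i b. i \<le> 4 \<Longrightarrow> b \<in> elems C \<Longrightarrow> e_op D i (h b) = map_option h (e_op C i b)"
    and f: "\<And>i b. i \<le> 4 \<Longrightarrow> b \<in> elems C \<Longrightarrow> f_op D i (h b) = map_option h (f_op C i b)"
    and eps: "\<And>i b. i \<le> 4 \<Longrightarrow> b \<in> elems C \<Longrightarrow> eps D i (h b) = eps C i b"
    and phi: "\<And>i b. i \<le> 4 \<Longrightarrow> b \<in> elems C \<Longrightarrow> phi D i (h b) = phi C i b"
    and e_in: "\<And>i b b'. i \<le> 4 \<Longrightarrow> b \<in> elems C \<Longrightarrow> e_op C i b = Some b' \<Longrightarrow> b' \<in> elems C"
    and f_in: "\<And>i b b'. i \<le> 4 \<Longrightarrow> b \<in> elems C \<Longrightarrow> f_op C i b = Some b' \<Longrightarrow> b' \<in> elems C"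
  shows "classical_crystal_iso T C D h"
proof -
  have hin: "h b \<in> elems D" if "b \<in> elems C" for b
    using bij that by (auto simp: bij_betw_def)
  have inj: "h b = h b' \<longleftrightarrow> b = b'" if "b \<in> elems C" "b' \<in> elems C" for b b'
    using bij that by (auto simp: bij_betw_def inj_on_def)
  have Dw: "wt D y \<in> classical_weights" if "y \<in> elems D" for y
    using D that unfolding classical_crystal_def by blast
  have Dc: "phi D i y = eps D i y + wt D y i \<and>
      (\<forall>b'. e_op D i y = Some b' \<longrightarrow>
         b' \<in> elems D \<and> wt D b' = wt D y + fst (simple_root T i) \<and>
         eps D i b' = eps D i y - 1 \<and> phi D i b' = phi D i y + 1) \<and>
      (\<forall>b'. f_op D i y = Some b' \<longrightarrow>
         b' \<in> elems D \<and> wt D b' = wt D y - fst (simple_root T i) \<and>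
         eps D i b' = eps D i y + 1 \<and> phi D i b' = phi D i y - 1) \<and>
      (\<forall>b' \<in> elems D. f_op D i y = Some b' \<longleftrightarrow> e_op D i b' = Some y)" if "i \<le> 4" "y \<in> elems D" for i y
    using D that unfolding classical_crystal_def by blast
  have "classical_crystal T C"
    unfolding classical_crystal_def
  proof (intro conjI allI ballI impI)
    fix b assume b: "b \<in> elems C"
    show "wt C b \<in> classical_weights" using Dw[OF hin[OF b]] by (simp add: wt b)
    fix i :: nat assume i: "i \<le> 4"
    note Db = Dc[OF i hin[OF b]]
    show "phi C i b = eps C i b + wt C b i"
      using Db by (simp add: i b wt eps phi)
    fix b'
    show "e_op C i b = Some b' \<Longrightarrow> b' \<in> elems C" "f_op C i b = Some b' \<Longrightarrow> b' \<in> elems C"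
      using e_in f_in i b by blast+
    {
      assume *: "e_op C i b = Some b'"
      with e_in i b have b': "b' \<in> elems C" by blast
      have "e_op D i (h b) = Some (h b')" using * e i b by simp
      with Db show "wt C b' = wt C b + fst (simple_root T i)" "eps C i b' = eps C i b - 1" "phi C i b' = phi C i b + 1"
        by (simp_all add: i b b' wt eps phi)
    }
    {
      assume *: "f_op C i b = Some b'"
      with f_in i b have b': "b' \<in> elems C" by blast
      have "f_op D i (h b) = Some (h b')" using * f i b by simp
      with Db show "wt C b' = wt C b - fst (simple_root T i)" "eps C i b' = eps C i b + 1" "phi C i b' = phi C i b - 1"
        by (simp_all add: i b b' wt eps phi)
    }
    assume b': "b' \<in> elems C"
    have "f_op C i b = Some b' \<longleftrightarrow> f_op D i (h b) = Some (h b')"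
      using f_in[OF i b] inj[OF _ b'] by (auto simp: f i b)
    also have "\<dots> \<longleftrightarrow> e_op D i (h b') = Some (h b)" using Db hin[OF b'] by blast
    also have "\<dots> \<longleftrightarrow> e_op C i b' = Some b"
      using e_in[OF i b'] inj[OF _ b] by (auto simp: e i b')
    finally show "(f_op C i b = Some b') = (e_op C i b' = Some b)" .
  qed
  then show ?thesis
    using assms unfolding classical_crystal_iso_def by blast
qed

section \<open>Columns as finite lists of blocks\<close>

lemma mem_shift: "(l, m) \<in> shift k Y \<longleftrightarrow> (l, m - k) \<in> Y"
  by (force simp: shift_def)

lemma shift_shift [simp]: "shift j (shift k Y) = shift (k + j) Y"
  by (auto simp: mem_shift algebra_simps)

lemma shift_0 [simp]: "shift 0 Y = Y"
  by (auto simp: mem_shift)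

lemma shift_eq_iff: "shift k Y = Z \<longleftrightarrow> Y = shift (- k) Z"
  by auto

lemma shift_insert: "shift k (insert b Y) = insert (fst b, snd b + k) (shift k Y)"
  by (cases b) (auto simp: shift_def)

lemma shift_remove: "shift k (Y - {b}) = shift k Y - {(fst b, snd b + k)}"
  by (auto simp: mem_shift)

lemma pre_young_shiftI:
  assumes "pre_young pt Y" shows "pre_young pt (shift k Y)"
proof -
  from assms obtain N where N: "\<forall>b\<in>Y. row pt b \<le> N" by (auto simp: pre_young_def)
  have "\<forall>b\<in>shift k Y. row pt b \<le> N + 4 * k"
    using N by (fastforce simp: shift_def row_def)
  moreover have "rests_on pt b \<subseteq> shift k Y" if "b \<in> shift k Y" for b
  proof -
    from that have "rests_on pt (fst b, snd b - k) \<subseteq> Y"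
      using assms by (cases b) (auto simp: pre_young_def mem_shift)
    then show ?thesis by (fastforce simp: rests_on_def mem_shift)
  qed
  ultimately show ?thesis using assms by (auto simp: pre_young_def shift_def)
qed

lemma pre_young_shift [simp]: "pre_young pt (shift k Y) \<longleftrightarrow> pre_young pt Y"
  using pre_young_shiftI[of pt Y k] pre_young_shiftI[of pt "shift k Y" "- k"] by auto

lemma free_block_shift: "free_block pt (shift k Y) (l, m) \<longleftrightarrow> free_block pt Y (l, m - k)"
  using pre_young_shift[of pt k "Y - {(l, m - k)}"]
  by (simp add: free_block_def mem_shift shift_remove)

text \<open>A shift moves every row by the same amount \<open>4 * k\<close>, so comparisons of rows,
  and with them the highest row, are preserved.\<close>

lemma exceptional_shiftI:
  assumes "exceptional pt Y" shows "exceptional pt (shift k Y)"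
proof -
  let ?P = "\<lambda>Y b. free_block pt Y b \<and> colour pt b = 2 \<and> (\<forall>b'\<in>Y. row pt b' \<le> row pt b)"
  have "(\<forall>b\<in>shift k Y. row pt b \<le> row pt (l, m)) \<longleftrightarrow> (\<forall>b\<in>Y. row pt b \<le> row pt (l, m - k))" for l m
    by (auto simp: shift_def row_def algebra_simps)
  then have P: "?P (shift k Y) (l, m) \<longleftrightarrow> ?P Y (l, m - k)" for l m
    by (simp add: free_block_shift colour_def)
  from assms have "\<exists>!b. ?P Y b" unfolding exceptional_def by blast
  then obtain b where b: "?P Y b" "\<And>c. ?P Y c \<Longrightarrow> c = b" by blast
  have "\<exists>!b. ?P (shift k Y) b"
  proof
    show "?P (shift k Y) (fst b, snd b + k)" unfolding P using b(1) by simp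
    fix c assume "?P (shift k Y) c"
    then have "?P Y (fst c, snd c - k)" using P[of "fst c" "snd c"] by simp
    from b(2)[OF this] show "c = (fst b, snd b + k)" by auto
  qed
  moreover from assms obtain b where "free_block pt Y b" "colour pt b = 1"
    by (auto simp: exceptional_def)
  then have "free_block pt (shift k Y) (fst b, snd b + k)" "colour pt (fst b, snd b + k) = 1"
    by (simp_all add: free_block_shift colour_def)
  ultimately show ?thesis using assms by (auto simp: exceptional_def)
qed

lemma exceptional_shift [simp]: "exceptional pt (shift k Y) \<longleftrightarrow> exceptional pt Y"
  using exceptional_shiftI[of pt Y k] exceptional_shiftI[of pt "shift k Y" "- k"] by auto

lemma young_columns_shift [simp]: "shift k Y \<in> young_columns pt \<longleftrightarrow> Y \<in> young_columns pt"
  by (simp add: young_columns_def)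

lemma addable_shift: "addable pt i (shift k Y) = shift k (addable pt i Y)"
proof -
  have "insert (l, m) (shift k Y) \<in> young_columns pt \<longleftrightarrow> insert (l, m - k) Y \<in> young_columns pt" for l m
    using young_columns_shift[of k "insert (l, m - k) Y" pt] by (simp add: shift_insert)
  then show ?thesis by (auto simp: addable_def mem_shift colour_def)
qed

lemma removable_shift: "removable pt i (shift k Y) = shift k (removable pt i Y)"
proof -
  have "shift k Y - {(l, m)} \<in> young_columns pt \<longleftrightarrow> Y - {(l, m - k)} \<in> young_columns pt" for l m
    using young_columns_shift[of k "Y - {(l, m - k)}" pt] by (simp add: shift_remove)
  then show ?thesis by (auto simp: removable_def mem_shift colour_def)
qed

lemma column_rel_iff:
  "(Y, Y') \<in> column_rel pt \<longleftrightarrow> Y \<in> young_columns pt \<and> (\<exists>k. Y' = shift k Y)"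
  by (auto simp: column_rel_def)

text \<open>\<open>arg_max_on\<close> is a choice; strict maximality leaves it only one
  candidate.\<close>

lemma col_f_eqI:
  assumes "\<not> (\<exists>j. j \<noteq> i \<and> Y \<in> labelled_class pt (R j))" and b: "b \<in> addable pt i Y"
    and max: "\<And>c. c \<in> addable pt i Y \<Longrightarrow> c = b \<or> row pt c < row pt b"
  shows "col_f pt i Y = Some (insert b Y)"
proof -
  have "arg_max_on (row pt) (addable pt i Y) = b"
    unfolding arg_max_on_def arg_max_def is_arg_max_def
    by (rule some_equality) (use b max in \<open>force, blast\<close>)
  with assms show ?thesis by (auto simp: col_f_def)
qed

lemma col_e_eqI:
  assumes "\<not> (\<exists>j. j \<noteq> i \<and> Y \<in> labelled_class pt (R j))" and b: "b \<in> removable pt i Y"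
    and min: "\<And>c. c \<in> removable pt i Y \<Longrightarrow> c = b \<or> row pt b < row pt c"
  shows "col_e pt i Y = Some (Y - {b})"
proof -
  have "arg_min_on (row pt) (removable pt i Y) = b"
    unfolding arg_min_on_def arg_min_def is_arg_min_def
    by (rule some_equality) (use b min in \<open>force, blast\<close>)
  with assms show ?thesis by (auto simp: col_e_def)
qed

text \<open>
  A finite list \<open>xs\<close> of blocks stands for the column made of \<open>xs\<close> and of a base common to all columns
  of the table: the blocks of negative index and those of index 0 whose letter is not in \<open>H\<close>.
\<close>

definition occupied :: "'l list \<Rightarrow> 'l block list \<Rightarrow> 'l block \<Rightarrow> bool" where
  "occupied H xs b \<longleftrightarrow> snd b < 0 \<or> b \<in> set xs \<or> snd b = 0 \<and> fst b \<notin> set H"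

definition carried where
  "carried sp H xs b \<longleftrightarrow> (\<forall>(l, k) \<in> sp (fst b). occupied H xs (l, snd b + k))"

text \<open>Only listed blocks are inspected: a block of the base rests on base blocks alone
  (\<open>base_closed\<close>), so it never holds down a listed block.\<close>

definition bare where
  "bare sp xs b \<longleftrightarrow> (\<forall>c \<in> set xs. \<forall>(l, k) \<in> sp (fst c). (l, snd c + k) \<noteq> b)"

definition top2 where
  "top2 cl rw sp xs b \<longleftrightarrow> cl (fst b) = (2::nat) \<and>
     (\<forall>c \<in> set xs. 4 * snd c + rw (fst c) \<le> 4 * snd b + rw (fst b)) \<and> bare sp xs b"

definition exceptional_list where
  "exceptional_list cl rw sp xs \<longleftrightarrow>
     (\<exists>b \<in> set xs. top2 cl rw sp xs b \<and> (\<forall>c \<in> set xs. c = b \<or> \<not> top2 cl rw sp xs c)) \<and>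
     (\<exists>b \<in> set xs. cl (fst b) = 1 \<and> bare sp xs b)"

definition addable_list where
  "addable_list cl rw sp H ls i xs = filter (\<lambda>b. cl (fst b) = i \<and> \<not> occupied H xs b \<and> carried sp H xs b \<and>
     \<not> exceptional_list cl rw sp (b # xs)) (List.product ls [0, 1, 2])"

definition removable_list where
  "removable_list cl rw sp i xs = filter (\<lambda>b. cl (fst b) = i \<and> bare sp xs b \<and>
     \<not> exceptional_list cl rw sp (filter (\<lambda>c. c \<noteq> b) xs)) xs"

definition same_column :: "'l list \<Rightarrow> 'l list \<Rightarrow> 'l block list \<Rightarrow> int \<Rightarrow> 'l block list \<Rightarrow> bool" where
  "same_column H ls xs s ys \<longleftrightarrow>
     (if s = 0 then (\<forall>b\<in>set xs. b \<in> set ys) \<and> (\<forall>b\<in>set ys. b \<in> set xs)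
      else \<forall>b \<in> set (List.product ls [- 1, 0, 1, 2, 3]). occupied H xs b \<longleftrightarrow> occupied H ys (fst b, snd b - s))"

fun blocked where
  "blocked i (R j) = (i \<noteq> j)"
| "blocked i _ = False"

definition zcount where
  "zcount cl xs = int (length (filter (\<lambda>b. cl (fst b) = (0::nat)) xs))"

definition cells :: "'l list \<Rightarrow> 'l block list \<Rightarrow> 'l block set" where
  "cells H xs = {b. occupied H xs b}"

definition framed :: "'l list \<Rightarrow> 'l list \<Rightarrow> 'l \<Rightarrow> 'l block list \<Rightarrow> bool" where
  "framed H Q q xs \<longleftrightarrow> (\<forall>b\<in>set xs. 0 \<le> snd b \<and> (snd b = 0 \<longrightarrow> fst b \<in> set H)) \<and>
     (\<forall>c\<in>set Q. (c, 0) \<in> set xs)"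

text \<open>
  \<open>(q, 0)\<close> is the removable block of the lowest column of the table.  It is kept out of the base,
  together with the blocks \<open>(c, 0)\<close>, \<open>c \<in> Q\<close>, on which it rests: these cover the base, so that also after
  removing \<open>(q, 0)\<close> no block of the base becomes free.
\<close>

definition layout :: "('l \<Rightarrow> int) \<Rightarrow> ('l \<Rightarrow> 'l block set) \<Rightarrow> 'l list \<Rightarrow> 'l list \<Rightarrow> 'l list \<Rightarrow> 'l \<Rightarrow> bool" where
  "layout rw sp ls H Q q \<longleftrightarrow>
     (\<forall>l\<in>set ls. \<forall>(l', k)\<in>sp l. k = 0 \<and> l' \<noteq> l \<and> (l \<in> set H \<or> l' \<notin> set H) \<or> k = - 1) \<and>
     (\<forall>l\<in>set ls. (\<exists>c\<in>set ls. (l, 0) \<in> sp c) \<or> (\<exists>c\<in>set ls. c \<notin> set H \<and> (l, - 1) \<in> sp c)) \<and>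
     (\<forall>l\<in>set ls. l \<in> set H \<or> (\<exists>c\<in>set ls. (l, 0) \<in> sp c \<and> (c \<notin> set H \<or> c \<in> set Q))) \<and>
     (\<forall>c\<in>set Q. c \<in> set H \<and> (c, 0) \<in> sp q \<and>
        (\<forall>l\<in>set ls. (l \<in> set H \<or> rw l \<le> rw c) \<and> rw l - 4 \<le> rw c)) \<and> Q \<noteq> []"

text \<open>
  The index \<open>m - 1\<close> is missing from the assumption \<open>deep\<close>, as \<open>(l, m) \<in> Y\<close> does not imply
  \<open>(l, m - 1) \<in> Y\<close>: consecutive blocks with the same letter lie on opposite sides of the pattern.
\<close>

locale column_layout =
  fixes pt :: "'l pattern" and cl :: "'l \<Rightarrow> nat" and rw :: "'l \<Rightarrow> int" and sp :: "'l \<Rightarrow> 'l block set"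
    and ls H Q :: "'l list" and q :: 'l
  assumes pt: "colour_of pt = cl" "row_of pt = rw" "support pt = sp"
    and ls: "set ls = UNIV" and layout: "layout rw sp ls H Q q"
    and deep: "\<And>Y l m l'. pre_young pt Y \<Longrightarrow> (l, m) \<in> Y \<Longrightarrow> (l', m - 2) \<in> Y \<and> (l', m - 3) \<in> Y"
begin

lemma sp_cases: "(l', k) \<in> sp l \<Longrightarrow> k = 0 \<and> l' \<noteq> l \<and> (l \<in> set H \<or> l' \<notin> set H) \<or> k = - 1"
  using layout unfolding layout_def ls by blast

lemma covered_low: "(\<exists>c. (l, 0) \<in> sp c) \<or> (\<exists>c. c \<notin> set H \<and> (l, - 1) \<in> sp c)"
  using layout unfolding layout_def ls by blast

lemma covered_top: "l \<notin> set H \<Longrightarrow> \<exists>c. (l, 0) \<in> sp c \<and> (c \<notin> set H \<or> c \<in> set Q)"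
  using layout unfolding layout_def ls by blast

lemma Q_props:
  assumes "c \<in> set Q"
  shows "c \<in> set H" "(c, 0) \<in> sp q" "l \<notin> set H \<Longrightarrow> rw l \<le> rw c" "rw l - 4 \<le> rw c"
  using layout assms unfolding layout_def ls by blast+

lemma Q_nonempty: "Q \<noteq> []"
  using layout unfolding layout_def by blast

lemma colour: "colour pt b = cl (fst b)" and row: "row pt b = 4 * snd b + rw (fst b)"
  by (simp_all add: colour_def row_def pt)

lemma rests_on: "c \<in> rests_on pt b \<longleftrightarrow> (fst c, snd c - snd b) \<in> sp (fst b)"
proof
  assume "(fst c, snd c - snd b) \<in> sp (fst b)"
  then show "c \<in> rests_on pt b"
    unfolding rests_on_def pt by (intro CollectI exI[of _ "fst c"] exI[of _ "snd c - snd b"]) simp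
qed (auto simp: rests_on_def pt)

lemma mem_cells: "b \<in> cells H xs \<longleftrightarrow> occupied H xs b"
  by (simp add: cells_def)

lemma carried_iff: "carried sp H xs b \<longleftrightarrow> rests_on pt b \<subseteq> cells H xs"
  by (force simp: carried_def rests_on cells_def)

lemma bare_iff: "bare sp xs b \<longleftrightarrow> (\<forall>c\<in>set xs. b \<notin> rests_on pt c)"
  by (force simp: bare_def rests_on)

lemma not_self_resting: "b \<notin> rests_on pt b"
  using sp_cases[of "fst b" 0 "fst b"] by (auto simp: rests_on)

lemma base_closed:
  assumes "occupied H [] b" "c \<in> rests_on pt b" shows "occupied H [] c"
  using assms sp_cases[of "fst c" "snd c - snd b" "fst b"] by (auto simp: occupied_def rests_on)

lemma base_cells: "occupied H [] b \<Longrightarrow> occupied H xs b"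
  by (auto simp: occupied_def)

lemma occupied_iff: "occupied H xs b \<longleftrightarrow> b \<in> set xs \<or> occupied H [] b"
  by (auto simp: occupied_def)

lemma framed_not_base: "framed H Q q xs \<Longrightarrow> b \<in> set xs \<Longrightarrow> \<not> occupied H [] b"
  by (force simp: framed_def occupied_def)

lemma pre_young_cells: "pre_young pt (cells H xs) \<longleftrightarrow> (\<forall>b\<in>set xs. carried sp H xs b)"
proof
  assume "pre_young pt (cells H xs)"
  then show "\<forall>b\<in>set xs. carried sp H xs b"
    by (auto simp: pre_young_def carried_iff mem_cells occupied_iff[of xs])
next
  assume c: "\<forall>b\<in>set xs. carried sp H xs b"
  \<comment> \<open>The full layer of index 0 is included since it lies above every block of
    negative index with the same letter.\<close>
  define N where "N = Max (row pt ` (set xs \<union> (\<lambda>l. (l, 0)) ` set ls))"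
  have fin: "finite (row pt ` (set xs \<union> (\<lambda>l. (l, 0)) ` set ls))" by simp
  have N0: "row pt b \<le> N" if "b \<in> set xs \<or> snd b = 0" for b
    unfolding N_def using that by (intro Max_ge[OF fin]) (cases b, auto simp: ls)
  have "row pt b \<le> N" if "b \<in> cells H xs" for b
  proof -
    have "row pt b \<le> row pt (fst b, 0)" if "snd b < 0" using that by (simp add: row)
    with N0[of "(fst b, 0)"] N0[of b] that show ?thesis
      by (fastforce simp: mem_cells occupied_def)
  qed
  moreover have "rests_on pt b \<subseteq> cells H xs" if "b \<in> cells H xs" for b
  proof (cases "b \<in> set xs")
    case True
    with c show ?thesis by (simp add: carried_iff)
  next
    case False
    with that have "occupied H [] b" by (simp add: mem_cells occupied_iff[of xs])
    then show ?thesis by (meson base_closed base_cells mem_cells subsetI)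
  qed
  moreover have "(undefined, - 1) \<in> cells H xs" by (simp add: mem_cells occupied_def)
  ultimately show "pre_young pt (cells H xs)" unfolding pre_young_def by blast
qed

text \<open>Keeps free blocks inside the finite list. A block of negative index may be covered from
  one index higher, possibly 0, which is why \<open>covered_low\<close> then asks for a letter
  outside \<open>H\<close>; at index 0 the cover lies in the base or is one of the framing blocks
  from \<open>Q\<close>.\<close>

lemma base_covered:
  assumes fr: "framed H Q q xs" and b: "occupied H [] b"
  shows "\<exists>c. c \<in> cells H xs \<and> b \<in> rests_on pt c"
proof (cases "snd b < 0")
  case True
  from covered_low[of "fst b"] show ?thesis
  proof
    assume "\<exists>c. (fst b, 0) \<in> sp c"
    then obtain c where "(fst b, 0) \<in> sp c" by blast
    with True show ?thesis
      by (intro exI[of _ "(c, snd b)"]) (simp add: mem_cells occupied_def rests_on)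
  next
    assume "\<exists>c. c \<notin> set H \<and> (fst b, - 1) \<in> sp c"
    then obtain c where "c \<notin> set H" "(fst b, - 1) \<in> sp c" by blast
    with True show ?thesis
      by (intro exI[of _ "(c, snd b + 1)"]) (auto simp: mem_cells occupied_def rests_on)
  qed
next
  case False
  with b have "fst b \<notin> set H" "snd b = 0" by (auto simp: occupied_def)
  moreover from covered_top[OF this(1)]
  obtain c where "(fst b, 0) \<in> sp c" "c \<notin> set H \<or> c \<in> set Q" by blast
  ultimately show ?thesis using fr
    by (intro exI[of _ "(c, 0)"]) (auto simp: mem_cells occupied_def framed_def rests_on)
qed

lemma cells_Cons: "insert b (cells H xs) = cells H (b # xs)"
  by (auto simp: cells_def occupied_def)

lemma cells_remove:
  "framed H Q q xs \<Longrightarrow> b \<in> set xs \<Longrightarrow> cells H xs - {b} = cells H (filter (\<lambda>c. c \<noteq> b) xs)"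
  using framed_not_base[of xs b] occupied_iff[of xs] occupied_iff[of "filter (\<lambda>c. c \<noteq> b) xs"]
  by (auto simp: mem_cells)

lemma free_cells:
  assumes fr: "framed H Q q xs" and py: "pre_young pt (cells H xs)"
  shows "free_block pt (cells H xs) b \<longleftrightarrow> b \<in> set xs \<and> bare sp xs b"
proof
  assume free: "free_block pt (cells H xs) b"
  then have only: "b \<notin> rests_on pt c" if "c \<in> cells H xs" for c
    using that not_self_resting[of b] unfolding free_block_def pre_young_def by blast
  with base_covered[OF fr, of b] free have "b \<in> set xs"
    by (auto simp: free_block_def mem_cells occupied_iff[of xs b])
  moreover have "bare sp xs b"
    using only by (auto simp: bare_iff mem_cells occupied_iff[of xs])
  ultimately show "b \<in> set xs \<and> bare sp xs b" ..
next
  assume b: "b \<in> set xs \<and> bare sp xs b"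
  then have nb: "\<not> occupied H [] b" using fr framed_not_base by blast
  have "b \<notin> rests_on pt c" if "c \<in> cells H xs" for c
    using that b nb by (metis bare_iff base_closed mem_cells occupied_iff)
  moreover have "(undefined, - 1) \<in> cells H xs - {b}"
    using nb by (auto simp: mem_cells occupied_def)
  ultimately show "free_block pt (cells H xs) b"
    using py b unfolding free_block_def pre_young_def
    by (auto simp: mem_cells occupied_iff[of xs b])
qed

text \<open>The free blocks are listed ones by \<open>free_cells\<close>, and the highest row is
  attained in the list because a framing block is at least as high as the whole base.\<close>

lemma exceptional_cells:
  assumes fr: "framed H Q q xs" and py: "pre_young pt (cells H xs)"
  shows "exceptional pt (cells H xs) \<longleftrightarrow> exceptional_list cl rw sp xs"
proof -
  obtain p where p: "p \<in> set Q" using Q_nonempty by (cases Q) auto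
  with fr have p': "(p, 0) \<in> set xs" by (auto simp: framed_def)
  have "row pt c \<le> row pt (p, 0)" if "occupied H [] c" for c
  proof (cases "snd c < 0")
    case True
    with Q_props(4)[OF p, of "fst c"] show ?thesis by (simp add: row)
  next
    case False
    with that Q_props(3)[OF p, of "fst c"] show ?thesis by (auto simp: row occupied_def)
  qed
  with p' have all: "(\<forall>c\<in>cells H xs. row pt c \<le> row pt b) \<longleftrightarrow> (\<forall>c\<in>set xs. row pt c \<le> row pt b)" for b
    by (fastforce simp: mem_cells occupied_iff[of xs])
  have top2: "free_block pt (cells H xs) b \<and> colour pt b = 2 \<and> (\<forall>c\<in>cells H xs. row pt c \<le> row pt b)
      \<longleftrightarrow> b \<in> set xs \<and> top2 cl rw sp xs b" for b
    unfolding all free_cells[OF assms] top2_def by (auto simp: colour row)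
  \<comment> \<open>Turns unique existence into bounded quantifiers, the form that
    \<open>exceptional_list\<close> can evaluate.\<close>
  have ex1: "(\<exists>!b. b \<in> set xs \<and> P b) \<longleftrightarrow> (\<exists>b\<in>set xs. P b \<and> (\<forall>c\<in>set xs. c = b \<or> \<not> P c))" for P
    unfolding Ex1_def by blast
  show ?thesis
    unfolding exceptional_def top2 exceptional_list_def ex1
    unfolding free_cells[OF assms] colour using py by blast
qed

lemma young_cells:
  assumes "framed H Q q xs"
  shows "cells H xs \<in> young_columns pt \<longleftrightarrow> (\<forall>b\<in>set xs. carried sp H xs b) \<and> \<not> exceptional_list cl rw sp xs"
  using exceptional_cells[OF assms] by (auto simp: young_columns_def pre_young_cells)

text \<open>The assumption \<open>deep\<close> supplies the indices \<open>m - 2\<close> and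
  \<open>m - 3\<close>; from these two starting points the induction descends in steps of
  two.\<close>

lemma deep_below:
  assumes "pre_young pt Y" "(l, m) \<in> Y" "m' \<le> m - 2" shows "(l', m') \<in> Y"
proof -
  have "(l', m - 2 - int n) \<in> Y" for l' n
  proof (induction n arbitrary: l' rule: less_induct)
    case (less n)
    consider "n = 0" | "n = 1" | k where "n = Suc (Suc k)" by (cases n; cases "n - 1") auto
    then show ?case
    proof cases
      case 3
      with less[of k l'] deep[OF assms(1), of l' "m - 2 - int k" l'] show ?thesis
        by (simp add: algebra_simps)
    qed (use deep[OF assms(1,2)] in auto)
  qed
  from this[of l' "nat (m - 2 - m')"] assms(3) show ?thesis by simp
qed

text \<open>The search can stop at index 2: an added block of index 3 or more would need all blocks
  of index 1 below it, contradicting the hole.\<close>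

lemma addable_cells:
  assumes fr: "framed H Q q xs" and car: "\<forall>b\<in>set xs. carried sp H xs b"
    and hole: "\<not> occupied H xs (l, 1)"
  shows "addable pt i (cells H xs) = set (addable_list cl rw sp H ls i xs)"
proof -
  have frC: "framed H Q q (b # xs)" if "\<not> occupied H xs b" for b
    using fr that by (auto simp: framed_def occupied_def)
  have carC: "(\<forall>c\<in>set (b # xs). carried sp H (b # xs) c) \<longleftrightarrow> carried sp H xs b" for b
    using car not_self_resting[of b] by (auto simp: carried_iff cells_Cons[symmetric])
  have win: "snd b \<in> {0, 1, 2}" if b: "\<not> occupied H xs b" "carried sp H xs b" for b
  proof -
    from carC[of b] b(2) have py: "pre_young pt (cells H (b # xs))" by (simp add: pre_young_cells)
    have "snd b < 3"
    proof (rule ccontr)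
      assume "\<not> snd b < 3"
      with deep_below[OF py, of "fst b" "snd b" 1 l] have "(l, 1) \<in> cells H (b # xs)"
        by (simp add: mem_cells occupied_def)
      with hole \<open>\<not> snd b < 3\<close> show False by (auto simp: mem_cells occupied_def)
    qed
    with b(1) show ?thesis by (auto simp: occupied_def)
  qed
  have "b \<in> addable pt i (cells H xs) \<longleftrightarrow> b \<in> set (addable_list cl rw sp H ls i xs)" for b
  proof (cases "occupied H xs b")
    case True
    then show ?thesis by (simp add: addable_def addable_list_def mem_cells)
  next
    case False
    have "b \<in> addable pt i (cells H xs) \<longleftrightarrow>
        cl (fst b) = i \<and> carried sp H xs b \<and> \<not> exceptional_list cl rw sp (b # xs)"
      unfolding addable_def cells_Cons
      using False by (simp add: young_cells[OF frC] carC[simplified] mem_cells colour)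
    with False win[of b] show ?thesis by (cases b) (auto simp: addable_list_def ls)
  qed
  then show ?thesis by blast
qed

text \<open>A removable block is free, hence listed. The block \<open>(q, 0)\<close> holds down the
  framing blocks, so the list is still framed after a removal and exceptionality can again be read
  off it.\<close>

lemma removable_cells:
  assumes fr: "framed H Q q xs" and car: "\<forall>b\<in>set xs. carried sp H xs b" and q: "(q, 0) \<in> set xs"
  shows "removable pt i (cells H xs) = set (removable_list cl rw sp i xs)"
proof -
  have py: "pre_young pt (cells H xs)" using car by (simp add: pre_young_cells)
  have "b \<in> removable pt i (cells H xs) \<longleftrightarrow> b \<in> set (removable_list cl rw sp i xs)" for b
  proof (cases "b \<in> set xs \<and> bare sp xs b")
    case False
    then have "\<not> free_block pt (cells H xs) b" by (simp add: free_cells[OF fr py])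
    with False show ?thesis
      by (auto simp: removable_def free_block_def young_columns_def removable_list_def)
  next
    case True
    let ?ys = "filter (\<lambda>c. c \<noteq> b) xs"
    have "b \<noteq> (c, 0)" if "c \<in> set Q" for c
      using True q Q_props(2)[OF that] by (auto simp: bare_iff rests_on)
    with fr have frF: "framed H Q q ?ys" by (auto simp: framed_def)
    from True have eq: "cells H xs - {b} = cells H ?ys" using cells_remove[OF fr] by blast
    from True have "free_block pt (cells H xs) b" by (simp add: free_cells[OF fr py])
    then have pyF: "pre_young pt (cells H ?ys)" by (simp add: free_block_def eq)
    then have "b \<in> removable pt i (cells H xs) \<longleftrightarrow> cl (fst b) = i \<and> \<not> exceptional_list cl rw sp ?ys"
      using True young_cells[OF frF]
      by (auto simp: removable_def eq colour mem_cells occupied_def pre_young_cells)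
    with True show ?thesis by (simp add: removable_list_def)
  qed
  then show ?thesis by blast
qed

text \<open>With listed indices at most 2 and a shift by at most one, both columns contain
  everything below index -1 and nothing above index 3, so comparing the indices from -1 to 3 decides
  equality.\<close>

lemma same_column_cells:
  assumes "same_column H ls xs s ys" "s \<in> {0, 1, - 1}" "\<forall>b\<in>set xs. snd b \<le> 2" "\<forall>b\<in>set ys. snd b \<le> 2"
  shows "cells H xs = shift s (cells H ys)"
proof (cases "s = 0")
  case True
  with assms(1) have "set xs = set ys" unfolding same_column_def if_P[OF True] by blast
  with True show ?thesis by (simp add: cells_def occupied_def)
next
  case False
  have "occupied H xs (l, m) \<longleftrightarrow> occupied H ys (l, m - s)" for l m
  proof (cases "m \<in> {- 1, 0, 1, 2, 3}")
    case True
    then have "(l, m) \<in> set (List.product ls [- 1, 0, 1, 2, 3])" by (simp add: ls)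
    with assms(1) have "occupied H xs (l, m) \<longleftrightarrow> occupied H ys (fst (l, m), snd (l, m) - s)"
      unfolding same_column_def if_not_P[OF False] by blast
    then show ?thesis by simp
  next
    case False
    then consider "m < - 1" | "m > 3" by force
    then show ?thesis
    proof cases
      case 1
      with assms(2) show ?thesis by (auto simp: occupied_def)
    next
      case 2
      with assms(2-4) show ?thesis by (force simp: occupied_def)
    qed
  qed
  then show ?thesis by (auto simp: cells_def mem_shift)
qed

end

section \<open>Comparison with a table of columns\<close>

text \<open>Index 1 precedes index 0 so that, for a suitable order of \<open>ls\<close>, every block
  comes before those it rests on; \<open>ideals\<close> and \<open>top_down\<close> recurse from the
  end.\<close>

definition window :: "'l list \<Rightarrow> 'l block list" where
  "window ls = map (\<lambda>l. (l, 1)) ls @ map (\<lambda>l. (l, 0)) ls"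

fun ideals :: "('l \<Rightarrow> 'l block set) \<Rightarrow> 'l block list \<Rightarrow> 'l block list list" where
  "ideals sp [] = [[]]"
| "ideals sp (b # bs) = concat (map (\<lambda>xs.
     if \<forall>(l, k)\<in>sp (fst b). snd b + k < 0 \<or> (l, snd b + k) \<in> set xs then [xs, b # xs] else [xs]) (ideals sp bs))"

fun top_down :: "('l \<Rightarrow> 'l block set) \<Rightarrow> 'l block list \<Rightarrow> bool" where
  "top_down sp [] \<longleftrightarrow> True"
| "top_down sp (b # bs) \<longleftrightarrow>
     (\<forall>(l, k)\<in>sp (fst b). snd b + k < 0 \<or> (l, snd b + k) \<in> set bs) \<and> top_down sp bs"

text \<open>A table entry has a hole at index 1, so it is full up to index -1 or 0; the shift by
  \<open>s\<close> brings this index to -1. Filtering the fixed list \<open>window ls\<close> makes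
  equality of columns equality of lists.\<close>

definition canonical_form :: "'l list \<Rightarrow> 'l list \<Rightarrow> 'l block list \<Rightarrow> 'l block list" where
  "canonical_form H ls xs = (let s = (if \<forall>l\<in>set ls. occupied H xs (l, 0) then 1 else 0)
     in filter (\<lambda>b. occupied H xs (fst b, snd b + s)) (window ls))"

definition table_entry where
  "table_entry sp ls H Q q xs \<longleftrightarrow> framed H Q q xs \<and> (q, 0) \<in> set xs \<and>
     (\<forall>b\<in>set xs. snd b \<le> 2 \<and> carried sp H xs b) \<and> (\<exists>l\<in>set ls. \<not> occupied H xs (l, 1))"

text \<open>Ideals containing all of index 0 are set aside, since they come from columns that are
  not normalised to level -1.\<close>

definition complete_table where
  "complete_table sp ls fs \<longleftrightarrow>
     (\<forall>xs\<in>set (ideals sp (window ls)). (\<forall>l\<in>set ls. (l, 0) \<in> set xs) \<or> xs \<in> set fs)"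

fun walk :: "aff_type \<Rightarrow> nat list \<Rightarrow> vertex \<Rightarrow> vertex option" where
  "walk T [] v = Some v"
| "walk T (i # is) v = (if i \<le> 4 then case next_f T i v of None \<Rightarrow> None | Some u \<Rightarrow> walk T is u else None)"

fun root_height :: "vertex \<Rightarrow> int" where
  "root_height (X (a, b, c, d)) = a + b + c + d"
| "root_height _ = 0"

text \<open>
  Every vertex except \<open>Emp\<close> and \<open>X (theta T)\<close> lies below another one in the order of heights; the
  bound 20 only serves to make the ascent finite.
\<close>

definition below_theta where
  "below_theta T v \<longleftrightarrow> root_height v \<le> 20 \<and> (v = Emp \<or> v = X (theta T) \<or>
     (\<exists>i\<in>set [1..<5]. case next_e T i v of None \<Rightarrow> False | Some u \<Rightarrow> root_height u = root_height v + 1))"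

text \<open>
  Counting the 0-blocks determines the shift \<open>s\<close> between the column obtained and that of the table.
\<close>

definition f_agrees where
  "f_agrees T cl rw sp H ls N i v \<longleftrightarrow>
    (let xs = N v; A = (if blocked i v then [] else addable_list cl rw sp H ls i xs) in
     case next_f T i v of None \<Rightarrow> A = []
     | Some u \<Rightarrow> let ys = N u in 
       (\<exists>b\<in>set A. (\<forall>c\<in>set A. c = b \<or> 4 * snd c + rw (fst c) < 4 * snd b + rw (fst b)) \<and>
        (\<exists>s\<in>set [0, 1, - 1]. same_column H ls (b # xs) s ys \<and> zcount cl ys + s = zcount cl xs + of_bool (i = 0))))"

definition e_agrees where
  "e_agrees T cl rw sp H ls N i v \<longleftrightarrow>
    (let xs = N v; A = (if blocked i v then [] else removable_list cl rw sp i xs) in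
     case next_e T i v of None \<Rightarrow> A = []
     | Some u \<Rightarrow> let ys = N u in 
       (\<exists>b\<in>set A. (\<forall>c\<in>set A. c = b \<or> 4 * snd b + rw (fst b) < 4 * snd c + rw (fst c)) \<and>
        (\<exists>s\<in>set [0, 1, - 1]. same_column H ls (filter (\<lambda>c. c \<noteq> b) xs) s ys \<and> zcount cl ys + s = zcount cl xs - of_bool (i = 0))))"

section \<open>Levels of columns and reduction to a finite window\<close>

definition full :: "'l block set \<Rightarrow> int \<Rightarrow> bool" where
  "full Y j \<longleftrightarrow> (\<forall>l. \<forall>m\<le>j. (l, m) \<in> Y)"

definition level :: "'l block set \<Rightarrow> int \<Rightarrow> bool" where
  "level Y j \<longleftrightarrow> full Y j \<and> \<not> full Y (j + 1)"

lemma full_shift: "full (shift k Y) j \<longleftrightarrow> full Y (j - k)"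
proof
  assume *: "full (shift k Y) j"
  show "full Y (j - k)" unfolding full_def
  proof (intro allI impI)
    fix l m assume "m \<le> j - k"
    with * have "(l, m + k) \<in> shift k Y" by (simp add: full_def)
    then show "(l, m) \<in> Y" by (simp add: mem_shift)
  qed
qed (simp add: full_def mem_shift)

lemma level_shift: "level (shift k Y) j \<longleftrightarrow> level Y (j - k)"
  by (simp add: level_def full_shift algebra_simps)

lemma full_mono: "full Y j \<Longrightarrow> i \<le> j \<Longrightarrow> full Y i"
  by (auto simp: full_def)

lemma level_unique: "level Y i \<Longrightarrow> level Y j \<Longrightarrow> i = j"
  using full_mono[of Y i "j + 1"] full_mono[of Y j "i + 1"] by (fastforce simp: level_def)

text \<open>By \<open>top_down\<close>, when \<open>b\<close> is considered, all blocks of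
  nonnegative index on which it rests have already been decided.\<close>

lemma ideals_complete:
  assumes "top_down sp bs" "\<And>b l k. b \<in> Y \<Longrightarrow> (l, k) \<in> sp (fst b) \<Longrightarrow> (l, snd b + k) \<in> Y"
  shows "filter (\<lambda>b. b \<in> Y) bs \<in> set (ideals sp bs)"
  using assms(1)
proof (induction bs)
  case (Cons b bs)
  let ?xs = "filter (\<lambda>b. b \<in> Y) bs"
  have "\<forall>(l, k)\<in>sp (fst b). snd b + k < 0 \<or> (l, snd b + k) \<in> set ?xs" if "b \<in> Y"
    using Cons.prems assms(2)[OF that] by fastforce
  with Cons show ?case by (auto intro!: bexI[of _ ?xs])
qed simp

context column_layout
begin

text \<open>One block makes the column full far below it, and the bounded height prevents it from
  being full everywhere.\<close>

lemma level_exists: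
  assumes "pre_young pt Y" shows "\<exists>j. level Y j"
proof -
  obtain l m where lm: "(l, m) \<in> Y" using assms by (auto simp: pre_young_def)
  obtain M where M: "\<forall>b\<in>Y. row pt b \<le> M" using assms by (auto simp: pre_young_def)
  have 0: "full Y (m - 2)" using deep_below[OF assms lm] by (simp add: full_def)
  show ?thesis
  proof (rule ccontr)
    assume "\<nexists>j. level Y j"
    then have "full Y (m - 2 + int n)" for n
      by (induction n) (use 0 in \<open>auto simp: level_def algebra_simps\<close>)
    \<comment> \<open>Large enough that the row of \<open>(l, m - 2 + d)\<close> exceeds the bound
      \<open>M\<close>.\<close>
    moreover define d where "d = \<bar>M - rw l\<bar> + \<bar>m\<bar> + 3"
    ultimately have "full Y (m - 2 + int (nat d))" by blast
    then have "(l, m - 2 + d) \<in> Y" by (simp add: full_def d_def)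
    with M have "4 * (m - 2 + d) + rw l \<le> M" by (fastforce simp: row)
    moreover have "M - rw l - m + 3 \<le> d" "3 - m \<le> d" unfolding d_def by linarith+
    ultimately show False by (smt (verit))
  qed
qed

lemma level_bound:
  assumes "pre_young pt Y" "level Y (- 1)" "(l, m) \<in> Y" shows "m \<le> 1"
proof (rule ccontr)
  assume "\<not> m \<le> 1"
  with deep_below[OF assms(1,3)] have "full Y 0" by (simp add: full_def)
  with assms(2) show False by (simp add: level_def)
qed

text \<open>At level -1 everything of negative index is present, and \<open>level_bound\<close>
  excludes indices above 1.\<close>

lemma window_determines:
  assumes "pre_young pt Y" "pre_young pt Z" "level Y (- 1)" "level Z (- 1)"
    and eq: "filter (\<lambda>b. b \<in> Y) (window ls) = filter (\<lambda>b. b \<in> Z) (window ls)"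
  shows "Y = Z"
proof -
  have "(l, m) \<in> Y \<longleftrightarrow> (l, m) \<in> Z" for l m
  proof -
    consider "m \<le> - 1" | "m \<in> {0, 1}" | "m > 1" by force
    then show ?thesis
    proof cases
      case 1
      with assms(3,4) show ?thesis by (simp add: level_def full_def)
    next
      case 2
      then have "(l, m) \<in> set (window ls)" by (auto simp: window_def ls)
      with arg_cong[OF eq, of set] show ?thesis by auto
    next
      case 3
      with level_bound[OF assms(1,3), of l m] level_bound[OF assms(2,4), of l m] show ?thesis by linarith
    qed
  qed
  then show ?thesis by auto
qed

lemma canonical_form_level:
  assumes "table_entry sp ls H Q q xs" "level (cells H xs) j"
  shows "canonical_form H ls xs = filter (\<lambda>b. b \<in> shift (- 1 - j) (cells H xs)) (window ls)"
proof -
  obtain l where l: "\<not> occupied H xs (l, 1)" using assms(1) by (auto simp: table_entry_def)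
  have "full (cells H xs) (- 1)" by (simp add: full_def mem_cells occupied_def)
  moreover have "full (cells H xs) 0 \<longleftrightarrow> (\<forall>l\<in>set ls. occupied H xs (l, 0))"
  proof
    assume *: "\<forall>l\<in>set ls. occupied H xs (l, 0)"
    show "full (cells H xs) 0" unfolding full_def
    proof (intro allI impI)
      fix l and m :: int assume "m \<le> 0"
      then show "(l, m) \<in> cells H xs"
        using * by (cases "m = 0") (auto simp: mem_cells ls, simp add: occupied_def)
    qed
  qed (simp add: full_def mem_cells)
  moreover have "\<not> full (cells H xs) 1" using l by (auto simp: full_def mem_cells)
  ultimately have "level (cells H xs) (if \<forall>l\<in>set ls. occupied H xs (l, 0) then 0 else - 1)"
    by (simp add: level_def)
  with assms(2) have j: "j = (if \<forall>l\<in>set ls. occupied H xs (l, 0) then 0 else - 1)"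
    using level_unique by blast
  have "(l, m) \<in> shift (- 1 - j) (cells H xs) \<longleftrightarrow> occupied H xs (l, m + (1 + j))" for l m
    by (simp add: mem_shift mem_cells algebra_simps)
  moreover have "(if \<forall>l\<in>set ls. occupied H xs (l, 0) then 1 else 0) = 1 + j" by (simp add: j)
  ultimately show ?thesis
    unfolding canonical_form_def Let_def by (intro filter_cong) auto
qed

end

text \<open>Collects the finite facts that evaluation supplies for each type. \<open>N\<close>
  tabulates one column per vertex, \<open>E\<close> is the exceptional column, and
  \<open>w2\<close>, \<open>w3\<close> are closed walks at \<open>Emp\<close>.\<close>

locale column_table = column_layout pt cl rw sp ls H Q q
  for pt :: "'l pattern" and cl rw sp ls H Q q +
  fixes T :: aff_type and V :: "vertex list" and N :: "vertex \<Rightarrow> 'l block list" and E :: "'l block list"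
    and w2 w3 :: "nat list"
  assumes labels: "labels pt = (\<lambda>v. (v, cells H (N v))) ` set V"
    and V: "elems (perfect_crystal T) = set V"
    and crystal: "\<forall>i\<in>set [0..<5]. \<forall>v\<in>set V. crystal_at T V i v"
    and entries: "\<forall>v\<in>set V. table_entry sp ls H Q q (N v) \<and> \<not> exceptional_list cl rw sp (N v)"
    and exc_entry: "table_entry sp ls H Q q E \<and> exceptional_list cl rw sp E"
    and f_table: "\<forall>v\<in>set V. \<forall>i\<in>set [0..<5]. f_agrees T cl rw sp H ls N i v"
    and e_table: "\<forall>v\<in>set V. \<forall>i\<in>set [0..<5]. e_agrees T cl rw sp H ls N i v"
    and top_down: "top_down sp (window ls)"
    and complete: "complete_table sp ls (map (canonical_form H ls) (E # map N V))"
    and distinct: "distinct (map (canonical_form H ls) (map N V))"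
    and walks: "walk T w2 Emp = Some Emp" "count_list w2 0 = 2" "walk T w3 Emp = Some Emp" "count_list w3 0 = 3"
    and below_theta: "\<forall>v\<in>set V. below_theta T v"
begin

section \<open>Young columns as pairs of a vertex and a shift\<close>

definition col :: "vertex \<Rightarrow> int \<Rightarrow> 'l block set" where
  "col v k = shift k (cells H (N v))"

definition zeros :: "vertex \<Rightarrow> int" where
  "zeros v = zcount cl (N v)"

lemma shift_col [simp]: "shift j (col v k) = col v (k + j)"
  by (simp add: col_def)

lemma entry:
  assumes "v \<in> set V"
  shows "table_entry sp ls H Q q (N v)" "framed H Q q (N v)" "(q, 0) \<in> set (N v)" "\<forall>b\<in>set (N v). snd b \<le> 2"
    "\<forall>b\<in>set (N v). carried sp H (N v) b" "\<exists>l. \<not> occupied H (N v) (l, 1)" "\<not> exceptional_list cl rw sp (N v)"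
  using entries assms by (auto simp: table_entry_def)

lemma col_young: "v \<in> set V \<Longrightarrow> col v k \<in> young_columns pt"
  using entry[of v] by (simp add: col_def young_cells)

text \<open>Equal columns have equal canonical forms, and these are distinct in the table. The shift
  is then fixed by the uniqueness of the level: no column equals a proper shift of itself.\<close>

lemma col_inj:
  assumes v: "v \<in> set V" and u: "u \<in> set V" and eq: "col v k = col u j"
  shows "v = u \<and> k = j"
proof -
  from eq have eq': "cells H (N v) = shift (j - k) (cells H (N u))"
    by (simp add: col_def shift_eq_iff)
  have py: "pre_young pt (cells H (N u))" using entry[OF u] by (simp add: pre_young_cells)
  then obtain a where a: "level (cells H (N u)) a" using level_exists by blast
  then have b: "level (cells H (N v)) (a + (j - k))" by (simp add: eq' level_shift)
  have "canonical_form H ls (N v) = canonical_form H ls (N u)"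
    unfolding canonical_form_level[OF entry(1)[OF v] b] canonical_form_level[OF entry(1)[OF u] a] by (simp add: eq' algebra_simps)
  with distinct v u have "v = u" by (auto simp: distinct_map inj_on_def)
  with b have "level (cells H (N u)) (a + (j - k))" by simp
  from level_unique[OF a this] \<open>v = u\<close> show ?thesis by simp
qed

text \<open>The normalised column meets the window in one of the enumerated ideals, hence in the
  canonical form of \<open>E\<close> or of a table entry; only \<open>E\<close> is ruled out by
  non-exceptionality.\<close>

lemma young_col:
  assumes "Y \<in> young_columns pt" shows "\<exists>v\<in>set V. \<exists>k. Y = col v k"
proof -
  have py: "pre_young pt Y" and ne: "\<not> exceptional pt Y" using assms by (auto simp: young_columns_def)
  obtain j where j: "level Y j" using level_exists[OF py] by blast
  let ?Y = "shift (- 1 - j) Y"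
  have l: "level ?Y (- 1)" using j by (simp add: level_shift)
  have pyY: "pre_young pt ?Y" using py by simp
  let ?xs = "filter (\<lambda>b. b \<in> ?Y) (window ls)"
  have "(l, snd b + k) \<in> ?Y" if "b \<in> ?Y" "(l, k) \<in> sp (fst b)" for b l k
  proof -
    have "(l, snd b + k) \<in> rests_on pt b" using that(2) by (simp add: rests_on)
    with pyY that(1) show ?thesis by (auto simp: pre_young_def)
  qed
  from ideals_complete[OF top_down this] have "?xs \<in> set (ideals sp (window ls))" by blast
  moreover have "\<not> (\<forall>l\<in>set ls. (l, 0) \<in> set ?xs)"
  proof
    assume "\<forall>l\<in>set ls. (l, 0) \<in> set ?xs"
    then have 0: "(l, 0) \<in> ?Y" for l by (simp add: ls)
    have "(l, m) \<in> ?Y" if "m \<le> 0" for l m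
      using 0[of l] l that by (cases "m = 0") (auto simp: level_def full_def)
    with l show False by (simp add: level_def full_def)
  qed
  ultimately have "?xs \<in> set (map (canonical_form H ls) (E # map N V))"
    using complete unfolding complete_table_def by blast
  then obtain zs where zs: "zs = E \<or> zs \<in> N ` set V" "?xs = canonical_form H ls zs" by auto
  then have te: "table_entry sp ls H Q q zs" using entry exc_entry by auto
  then have pz: "pre_young pt (cells H zs)" by (simp add: pre_young_cells table_entry_def)
  obtain a where a: "level (cells H zs) a" using level_exists[OF pz] by blast
  have "?Y = shift (- 1 - a) (cells H zs)"
    by (rule window_determines)
      (use pyY pz l a zs(2) canonical_form_level[OF te a] in \<open>auto simp: level_shift\<close>)
  then have Y: "Y = shift (j - a) (cells H zs)" by (simp add: shift_eq_iff)
  have "zs \<noteq> E"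
  proof
    assume "zs = E"
    with exc_entry te pz have "exceptional pt Y"
      by (simp add: Y exceptional_cells table_entry_def)
    with ne show False ..
  qed
  with zs(1) Y show ?thesis by (auto simp: col_def)
qed

lemma young_columns_eq: "young_columns pt = {col v k | v k. v \<in> set V}"
  using young_col col_young by blast

lemma labelled_class_eq: "labelled_class pt v = (if v \<in> set V then range (col v) else {})"
proof -
  have "(v, Y) \<in> labels pt \<longleftrightarrow> v \<in> set V \<and> Y = col v 0" for Y
    by (auto simp: labels col_def)
  then show ?thesis
    by (auto simp: labelled_class_def column_rel_iff col_young)
qed

lemma column_rel_col: "v \<in> set V \<Longrightarrow> column_rel pt `` {col v k} = labelled_class pt v"
  by (auto simp: column_rel_iff labelled_class_eq col_young image_iff) (metis add.commute diff_add_cancel)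

lemma classes: "young_columns pt // column_rel pt = labelled_class pt ` set V"
proof (intro set_eqI iffI)
  fix c assume "c \<in> young_columns pt // column_rel pt"
  then obtain Y where "Y \<in> young_columns pt" "c = column_rel pt `` {Y}" by (rule quotientE)
  then show "c \<in> labelled_class pt ` set V" using young_col[of Y] column_rel_col by blast
next
  fix c assume "c \<in> labelled_class pt ` set V"
  then obtain v where "v \<in> set V" "c = labelled_class pt v" by blast
  then show "c \<in> young_columns pt // column_rel pt"
    using quotientI[OF col_young[of v 0], of "column_rel pt"] column_rel_col[of v 0] by simp
qed

lemma labelled_class_inj: "v \<in> set V \<Longrightarrow> labelled_class pt u = labelled_class pt v \<longleftrightarrow> u = v"
  using col_inj[of v u 0] by (auto simp: labelled_class_eq split: if_splits) blast

lemma label_map_labelled_class: "v \<in> set V \<Longrightarrow> label_map pt (labelled_class pt v) = v"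
  by (simp add: label_map_def labelled_class_inj)

lemma blocked_iff:
  assumes "v \<in> set V"
  shows "(\<exists>j. j \<noteq> i \<and> col v k \<in> labelled_class pt (R j)) \<longleftrightarrow> blocked i v"
proof -
  have "col v k \<in> labelled_class pt u \<longleftrightarrow> u = v" for u
    using col_inj[OF assms, of u k] assms by (auto simp: labelled_class_eq)
  then show ?thesis by (cases v) auto
qed

lemma next_in:
  assumes "v \<in> set V" "i \<le> 4" "next_f T i v = Some u \<or> next_e T i v = Some u"
  shows "u \<in> set V"
proof -
  have "crystal_at T V i v" using crystal assms by auto
  with assms(3) show ?thesis by (auto simp: crystal_at_def)
qed

text \<open>Up to a constant, \<open>k + zeros v\<close> counts the 0-blocks of
  \<open>col v k\<close>. Adding a block raises this by one for \<open>i = 0\<close> and leaves it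
  fixed otherwise, which determines the new shift.\<close>

lemma col_f_col:
  assumes v: "v \<in> set V" and i: "i \<le> 4"
  shows "col_f pt i (col v k) =
    map_option (\<lambda>u. col u (k + zeros v - zeros u + of_bool (i = 0))) (next_f T i v)"
proof -
  let ?A = "addable_list cl rw sp H ls i (N v)"
  obtain l where "\<not> occupied H (N v) (l, 1)" using entry(6)[OF v] by blast
  from addable_cells[OF entry(2)[OF v] entry(5)[OF v] this]
  have A: "addable pt i (col v k) = shift k (set ?A)" by (simp add: col_def addable_shift)
  have f: "f_agrees T cl rw sp H ls N i v" using f_table v i by auto
  show ?thesis
  proof (cases "next_f T i v")
    case None
    with f have "blocked i v \<or> set ?A = {}" by (auto simp: f_agrees_def Let_def split: if_splits)
    then have "blocked i v \<or> addable pt i (col v k) = {}" by (auto simp: A shift_def)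
    with None blocked_iff[OF v, of i k] show ?thesis by (auto simp: col_f_def)
  next
    case (Some u)
    have u: "u \<in> set V" using next_in[OF v i] Some by blast
    from f Some obtain b s where nb: "\<not> blocked i v" and b: "b \<in> set ?A"
      and max: "\<forall>c\<in>set ?A. c = b \<or> 4 * snd c + rw (fst c) < 4 * snd b + rw (fst b)"
      and s: "s \<in> {0, 1, - 1}" "same_column H ls (b # N v) s (N u)" "zeros u + s = zeros v + of_bool (i = 0)"
      by (fastforce simp: f_agrees_def Let_def zeros_def split: if_splits)
    have "col_f pt i (col v k) = Some (insert (fst b, snd b + k) (col v k))"
    proof (rule col_f_eqI)
      show "\<not> (\<exists>j. j \<noteq> i \<and> col v k \<in> labelled_class pt (R j))" using nb blocked_iff[OF v] by blast
      show "(fst b, snd b + k) \<in> addable pt i (col v k)" using b by (simp add: A mem_shift)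
      fix c assume "c \<in> addable pt i (col v k)"
      then have "(fst c, snd c - k) \<in> set ?A" by (cases c) (simp add: A mem_shift)
      with max show "c = (fst b, snd b + k) \<or> row pt c < row pt (fst b, snd b + k)"
        by (cases c) (fastforce simp: row)
    qed
    moreover have "insert (fst b, snd b + k) (col v k) = shift k (cells H (b # N v))"
      by (simp add: col_def shift_insert cells_Cons[symmetric])
    moreover have "cells H (b # N v) = shift s (cells H (N u))"
      by (rule same_column_cells[OF s(2,1)]) (use entry(4)[OF v] entry(4)[OF u] b in \<open>auto simp: addable_list_def\<close>)
    moreover have "s + k = k + zeros v - zeros u + of_bool (i = 0)" using s(3) by simp
    ultimately show ?thesis using Some by (simp add: col_def)
  qed
qed

lemma col_e_col:
  assumes v: "v \<in> set V" and i: "i \<le> 4"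
  shows "col_e pt i (col v k) =
    map_option (\<lambda>u. col u (k + zeros v - zeros u - of_bool (i = 0))) (next_e T i v)"
proof -
  let ?A = "removable_list cl rw sp i (N v)"
  from removable_cells[OF entry(2)[OF v] entry(5)[OF v] entry(3)[OF v]]
  have A: "removable pt i (col v k) = shift k (set ?A)" by (simp add: col_def removable_shift)
  have e: "e_agrees T cl rw sp H ls N i v" using e_table v i by auto
  show ?thesis
  proof (cases "next_e T i v")
    case None
    with e have "blocked i v \<or> set ?A = {}" by (auto simp: e_agrees_def Let_def split: if_splits)
    then have "blocked i v \<or> removable pt i (col v k) = {}" by (auto simp: A shift_def)
    with None blocked_iff[OF v, of i k] show ?thesis by (auto simp: col_e_def)
  next
    case (Some u)
    have u: "u \<in> set V" using next_in[OF v i] Some by blast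
    from e Some obtain b s where nb: "\<not> blocked i v" and b: "b \<in> set ?A"
      and min: "\<forall>c\<in>set ?A. c = b \<or> 4 * snd b + rw (fst b) < 4 * snd c + rw (fst c)"
      and s: "s \<in> {0, 1, - 1}" "same_column H ls (filter (\<lambda>c. c \<noteq> b) (N v)) s (N u)" "zeros u + s = zeros v - of_bool (i = 0)"
      by (fastforce simp: e_agrees_def Let_def zeros_def split: if_splits)
    have "col_e pt i (col v k) = Some (col v k - {(fst b, snd b + k)})"
    proof (rule col_e_eqI)
      show "\<not> (\<exists>j. j \<noteq> i \<and> col v k \<in> labelled_class pt (R j))" using nb blocked_iff[OF v] by blast
      show "(fst b, snd b + k) \<in> removable pt i (col v k)" using b by (simp add: A mem_shift)
      fix c assume "c \<in> removable pt i (col v k)"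
      then have "(fst c, snd c - k) \<in> set ?A" by (cases c) (simp add: A mem_shift)
      with min show "c = (fst b, snd b + k) \<or> row pt (fst b, snd b + k) < row pt c"
        by (cases c) (fastforce simp: row)
    qed
    moreover have "col v k - {(fst b, snd b + k)} = shift k (cells H (filter (\<lambda>c. c \<noteq> b) (N v)))"
      using b by (simp add: col_def shift_remove cells_remove[OF entry(2)[OF v], symmetric] removable_list_def)
    moreover have "cells H (filter (\<lambda>c. c \<noteq> b) (N v)) = shift s (cells H (N u))"
      by (rule same_column_cells[OF s(2,1)]) (use entry(4)[OF v] entry(4)[OF u] in auto)
    moreover have "s + k = k + zeros v - zeros u - of_bool (i = 0)" using s(3) by simp
    ultimately show ?thesis using Some by (simp add: col_def)
  qed
qed

end

lemma descendI: "c \<noteq> {} \<Longrightarrow> (\<And>Y. Y \<in> c \<Longrightarrow> g Y = x) \<Longrightarrow> descend g c = x"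
  unfolding descend_def by (metis image_cong image_constant_conv the_elem_eq)

section \<open>Weights of columns: consistency and reachability\<close>

lemma vertex_wt_step:
  assumes crys: "classical_crystal T (perfect_crystal T)" and "v \<in> elems (perfect_crystal T)"
    and "i \<le> 4" "next_f T i v = Some u"
  shows "vertex_wt T u = vertex_wt T v - fst (simple_root T i)"
proof -
  have "f_op (perfect_crystal T) i v = Some u \<Longrightarrow> wt (perfect_crystal T) u =
      wt (perfect_crystal T) v - fst (simple_root T i)"
    using crys assms(2,3) unfolding classical_crystal_def by blast
  with assms(3,4) show ?thesis by (simp add: perfect_crystal_def B_f_next_f)
qed

lemma next_f_e: "i \<le> 4 \<Longrightarrow> next_f T i v = Some u \<longleftrightarrow> next_e T i u = Some v"
  using arrow_next_f arrow_next_e by metis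

context column_table
begin

lemma perfect: "classical_crystal T (perfect_crystal T)"
  by (rule classical_crystal_perfect[OF V crystal])

lemma Emp_in: "Emp \<in> set V"
  unfolding V[symmetric] by (simp add: perfect_crystal_def)

text \<open>The explicit weight of \<open>col v k\<close>. Since \<delta> occurs in the simple root
  of index 0 only, its coefficient is minus the number of 0-blocks relative to the normalising
  column.\<close>

definition wt_of :: "aff_weight \<Rightarrow> int \<Rightarrow> vertex \<Rightarrow> int \<Rightarrow> aff_weight" where
  "wt_of \<mu> k\<^sub>0 v k = \<mu> + (vertex_wt T v, zeros Emp + k\<^sub>0 - zeros v - k)"

text \<open>Induction along the extension: \<open>wt_of\<close> holds at the start and changes by
  the simple root at each step. With \<open>col_inj\<close> this leaves at most one weight per
  column.\<close>

lemma has_wt_unique: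
  assumes "has_wt T pt (col Emp k\<^sub>0) \<mu> Y \<nu>"
  shows "\<exists>v k. v \<in> set V \<and> Y = col v k \<and> \<nu> = wt_of \<mu> k\<^sub>0 v k"
  using assms
proof induction
  case base
  have "\<mu> = wt_of \<mu> k\<^sub>0 Emp k\<^sub>0" by (simp add: wt_of_def prod_eq_iff)
  then show ?case using Emp_in by blast
next
  case (f_step Y \<nu> i Y')
  then obtain v k where v: "v \<in> set V" "Y = col v k" "\<nu> = wt_of \<mu> k\<^sub>0 v k" by blast
  with f_step obtain u where u: "next_f T i v = Some u" "Y' = col u (k + zeros v - zeros u + of_bool (i = 0))"
    by (auto simp: col_f_col)
  with v f_step vertex_wt_step[OF perfect, of v i u]
  have "\<nu> - simple_root T i = wt_of \<mu> k\<^sub>0 u (k + zeros v - zeros u + of_bool (i = 0))"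
    by (simp add: wt_of_def prod_eq_iff V) (simp add: simple_root_def)
  with u v f_step show ?case using next_in by blast
next
  case (e_step Y \<nu> i Y')
  then obtain v k where v: "v \<in> set V" "Y = col v k" "\<nu> = wt_of \<mu> k\<^sub>0 v k" by blast
  with e_step obtain u where u: "next_e T i v = Some u" "Y' = col u (k + zeros v - zeros u - of_bool (i = 0))"
    by (auto simp: col_e_col)
  then have uV: "u \<in> set V" using next_in v e_step by blast
  with v e_step u vertex_wt_step[OF perfect, of u i v]
  have "\<nu> + simple_root T i = wt_of \<mu> k\<^sub>0 u (k + zeros v - zeros u - of_bool (i = 0))"
    by (simp add: wt_of_def prod_eq_iff V next_f_e) (simp add: simple_root_def)
  with u uV show ?case by blast
qed

definition weighted :: "aff_weight \<Rightarrow> int \<Rightarrow> 'l block set \<Rightarrow> bool" where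
  "weighted \<mu> k\<^sub>0 Y \<longleftrightarrow> (\<exists>\<nu>. has_wt T pt (col Emp k\<^sub>0) \<mu> Y \<nu>)"

lemma weighted_f:
  assumes "weighted \<mu> k\<^sub>0 (col v k)" and v: "v \<in> set V" and i: "i \<le> 4" and u: "next_f T i v = Some u"
  shows "weighted \<mu> k\<^sub>0 (col u (k + zeros v - zeros u + of_bool (i = 0)))"
proof -
  obtain \<nu> where \<nu>: "has_wt T pt (col Emp k\<^sub>0) \<mu> (col v k) \<nu>"
    using assms(1) unfolding weighted_def by blast
  have "col_f pt i (col v k) = Some (col u (k + zeros v - zeros u + of_bool (i = 0)))"
    by (simp only: col_f_col[OF v i] u option.map)
  from has_wt.f_step[OF \<nu> i this] show ?thesis unfolding weighted_def by blast
qed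

lemma weighted_e:
  assumes "weighted \<mu> k\<^sub>0 (col v k)" and v: "v \<in> set V" and i: "i \<le> 4" and u: "next_e T i v = Some u"
  shows "weighted \<mu> k\<^sub>0 (col u (k + zeros v - zeros u - of_bool (i = 0)))"
proof -
  obtain \<nu> where \<nu>: "has_wt T pt (col Emp k\<^sub>0) \<mu> (col v k) \<nu>"
    using assms(1) unfolding weighted_def by blast
  have "col_e pt i (col v k) = Some (col u (k + zeros v - zeros u - of_bool (i = 0)))"
    by (simp only: col_e_col[OF v i] u option.map)
  from has_wt.e_step[OF \<nu> i this] show ?thesis unfolding weighted_def by blast
qed

text \<open>An equivalence, because each arrow can be undone by an \<open>e\<close> step; so walks
  also propagate reachability backwards.\<close>

lemma walk_weighted:
  assumes "walk T w v = Some u" "v \<in> set V"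
  shows "weighted \<mu> k\<^sub>0 (col v k) \<longleftrightarrow> weighted \<mu> k\<^sub>0 (col u (k + zeros v - zeros u + int (count_list w 0)))"
  using assms
proof (induction w arbitrary: v k)
  case (Cons i w)
  then obtain v' where i: "i \<le> 4" and v': "next_f T i v = Some v'" "walk T w v' = Some u"
    by (auto split: if_splits option.splits)
  then have V': "v' \<in> set V" using next_in Cons.prems by blast
  let ?k = "k + zeros v - zeros v' + of_bool (i = 0)"
  have "next_e T i v' = Some v" using v' i next_f_e by blast
  from weighted_e[OF _ V' i this, of \<mu> k\<^sub>0 ?k] weighted_f[OF _ Cons.prems(2) i v'(1), of \<mu> k\<^sub>0 k]
  have "weighted \<mu> k\<^sub>0 (col v k) \<longleftrightarrow> weighted \<mu> k\<^sub>0 (col v' ?k)" by auto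
  also have "\<dots> \<longleftrightarrow> weighted \<mu> k\<^sub>0 (col u (?k + zeros v' - zeros u + int (count_list w 0)))"
    using Cons.IH[OF v'(2) V'] by blast
  also have "?k + zeros v' - zeros u + int (count_list w 0) = k + zeros v - zeros u + int (count_list (i # w) 0)"
    by simp
  finally show ?case .
qed simp

text \<open>
  A closed walk at \<open>Emp\<close> shifts the column by the number of its 0-arrows.  There are always at least two
  of these, one out of \<open>Emp\<close> and one into it, so a shift by 1 needs one walk with two and one with three.
\<close>

lemma weighted_Emp: "weighted \<mu> k\<^sub>0 (col Emp k)"
proof -
  let ?w = "\<lambda>k. weighted \<mu> k\<^sub>0 (col Emp k)"
  have 2: "?w k \<longleftrightarrow> ?w (k + 2)" and 3: "?w k \<longleftrightarrow> ?w (k + 3)" for k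
    using walk_weighted[OF walks(1) Emp_in, of \<mu> k\<^sub>0 k] walk_weighted[OF walks(3) Emp_in, of \<mu> k\<^sub>0 k] walks(2,4)
    by auto
  have 1: "?w k \<longleftrightarrow> ?w (k + 1)" for k
    using 2[of "k + 1"] 3[of k] by (simp add: algebra_simps)
  have "?w k\<^sub>0" unfolding weighted_def using has_wt.base by blast
  then have "?w (k\<^sub>0 + int n) \<and> ?w (k\<^sub>0 - int n)" for n
  proof (induction n)
    case (Suc n)
    with 1[of "k\<^sub>0 + int n"] 1[of "k\<^sub>0 - int (Suc n)"] show ?case by (simp add: algebra_simps)
  qed simp
  from this[of "nat \<bar>k - k\<^sub>0\<bar>"] show ?thesis by (cases "k \<ge> k\<^sub>0") auto
qed

text \<open>Ascent in height along \<open>e\<close> arrows with nonzero index ends at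
  \<open>Emp\<close> or at \<open>X (theta T)\<close>, which is one 0-arrow away from
  \<open>Emp\<close>; descending again reaches \<open>v\<close> with any prescribed shift.\<close>

lemma weighted_col: "v \<in> set V \<Longrightarrow> weighted \<mu> k\<^sub>0 (col v k)"
proof (induction "nat (20 - root_height v)" arbitrary: v k rule: less_induct)
  case less
  have "below_theta T v" using below_theta less.prems by blast
  then consider "v = Emp" | "v = X (theta T)"
    | i u where "i \<in> {1..4}" "next_e T i v = Some u" "root_height u = root_height v + 1" "root_height v \<le> 20"
    by (fastforce simp: below_theta_def split: option.splits)
  then show ?case
  proof cases
    case 1
    then show ?thesis by (simp add: weighted_Emp)
  next
    case 2
    \<comment> \<open>The shift of \<open>Emp\<close> is chosen so that the 0-arrow lands exactly at
      shift \<open>k\<close>; the final -1 compensates for the added 0-block.\<close>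
    with weighted_f[OF weighted_Emp Emp_in, of 0 v \<mu> k\<^sub>0 "k - zeros Emp + zeros v - 1"] show ?thesis by simp
  next
    case 3
    then have u: "u \<in> set V" using next_in less.prems by auto
    moreover have "root_height u \<le> 20" using u below_theta by (auto simp: below_theta_def)
    ultimately have "weighted \<mu> k\<^sub>0 (col u (k + zeros v - zeros u))" using less.hyps[of u] 3 by simp
    from weighted_f[OF this u, of i v] 3 show ?thesis by (auto simp: next_f_e)
  qed
qed

lemma col_wt_col:
  assumes "v \<in> set V" shows "col_wt T pt (col Emp k\<^sub>0) \<mu> (col v k) = wt_of \<mu> k\<^sub>0 v k"
proof -
  have "\<nu> = wt_of \<mu> k\<^sub>0 v k" if "has_wt T pt (col Emp k\<^sub>0) \<mu> (col v k) \<nu>" for \<nu>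
    using has_wt_unique[OF that] col_inj[OF assms] by blast
  moreover from this have "has_wt T pt (col Emp k\<^sub>0) \<mu> (col v k) (wt_of \<mu> k\<^sub>0 v k)"
    using weighted_col[OF assms] unfolding weighted_def by blast
  ultimately show ?thesis unfolding col_wt_def by blast
qed

section \<open>The crystal on classes and the label isomorphism\<close>

definition vertex_of :: "'l block set \<Rightarrow> vertex" where
  "vertex_of Y = (THE v. v \<in> set V \<and> (\<exists>k. Y = col v k))"

lemma vertex_of_col: "v \<in> set V \<Longrightarrow> vertex_of (col v k) = v"
  unfolding vertex_of_def using col_inj by blast

lemma string_length_vertex:
  assumes g: "\<And>v k. v \<in> set V \<Longrightarrow> g (col v k) = map_option (\<lambda>u. col u (s v k u)) (nx v)"
    and nx: "\<And>v u. v \<in> set V \<Longrightarrow> nx v = Some u \<Longrightarrow> u \<in> set V" and v: "v \<in> set V"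
  shows "string_length g (col v k) = string_length nx v"
proof -
  have "string_length nx (vertex_of (col v k)) = string_length g (col v k)"
  proof (rule string_length_conj)
    fix Y assume "Y \<in> young_columns pt"
    then obtain w j where w: "w \<in> set V" "Y = col w j" using young_col by blast
    show "nx (vertex_of Y) = map_option vertex_of (g Y)"
      using nx[OF w(1)] by (cases "nx w") (simp_all add: w g vertex_of_col)
    fix Y' assume "g Y = Some Y'"
    with nx[OF w(1)] show "Y' \<in> young_columns pt" by (auto simp: w g col_young)
  qed (rule col_young[OF v])
  then show ?thesis by (simp add: vertex_of_col v)
qed

lemma string_length_col:
  assumes v: "v \<in> set V" and i: "i \<le> 4"
  shows "string_length (col_f pt i) (col v k) = string_length (next_f T i) v"
    and "string_length (col_e pt i) (col v k) = string_length (next_e T i) v"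
proof -
  show "string_length (col_f pt i) (col v k) = string_length (next_f T i) v"
    by (rule string_length_vertex[where s = "\<lambda>v k u. k + zeros v - zeros u + of_bool (i = 0)"]) (use col_f_col col_e_col next_in v i in blast)+
  show "string_length (col_e pt i) (col v k) = string_length (next_e T i) v"
    by (rule string_length_vertex[where s = "\<lambda>v k u. k + zeros v - zeros u - of_bool (i = 0)"]) (use col_f_col col_e_col next_in v i in blast)+
qed

text \<open>All these functions descend: within a class only \<open>k\<close> varies, and it affects
  neither the classical part of the weight, nor the class of the image, nor the string
  lengths.\<close>

lemma column_crystal_class:
  assumes v: "v \<in> set V" and i: "i \<le> 4"
  shows "wt (column_crystal T pt (col Emp k\<^sub>0) \<mu>) (labelled_class pt v) = fst \<mu> + vertex_wt T v" (is "wt ?C ?c = _")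
    and "f_op (column_crystal T pt (col Emp k\<^sub>0) \<mu>) i (labelled_class pt v) = map_option (labelled_class pt) (next_f T i v)"
    and "e_op (column_crystal T pt (col Emp k\<^sub>0) \<mu>) i (labelled_class pt v) = map_option (labelled_class pt) (next_e T i v)"
    and "phi (column_crystal T pt (col Emp k\<^sub>0) \<mu>) i (labelled_class pt v) = phi (perfect_crystal T) i v"
    and "eps (column_crystal T pt (col Emp k\<^sub>0) \<mu>) i (labelled_class pt v) = eps (perfect_crystal T) i v"
proof -
  have c: "?c = range (col v)" using v by (simp add: labelled_class_eq)
  then have "?c \<noteq> {}" by simp
  note desc = descendI[OF this]
  show "wt ?C ?c = fst \<mu> + vertex_wt T v"
    unfolding column_crystal_def crystal.simps
    by (rule desc) (auto simp: c col_wt_col v wt_of_def)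
  show "f_op ?C i ?c = map_option (labelled_class pt) (next_f T i v)"
    unfolding column_crystal_def crystal.simps
    by (rule desc) (use next_in[OF v i] in \<open>auto simp: c col_f_col v i column_rel_col option.map_comp
      intro!: option.map_cong\<close>)
  show "e_op ?C i ?c = map_option (labelled_class pt) (next_e T i v)"
    unfolding column_crystal_def crystal.simps
    by (rule desc) (use next_in[OF v i] in \<open>auto simp: c col_e_col v i column_rel_col option.map_comp
      intro!: option.map_cong\<close>)
  show "phi ?C i ?c = phi (perfect_crystal T) i v"
    unfolding column_crystal_def perfect_crystal_def crystal.simps
    by (rule desc) (auto simp: c string_length_col v i B_f_next_f)
  show "eps ?C i ?c = eps (perfect_crystal T) i v"
    unfolding column_crystal_def perfect_crystal_def crystal.simps
    by (rule desc) (auto simp: c string_length_col v i B_e_next_e)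
qed

lemma elems_column_crystal:
  "elems (column_crystal T pt Y\<^sub>0 \<mu>) = labelled_class pt ` elems (perfect_crystal T)"
  by (simp add: column_crystal_def classes V)

text \<open>The condition on \<open>\<mu>\<close> makes weights agree with those of the perfect
  crystal; \<open>column_crystal_wt\<close> treats any other normalisation as a translation.\<close>

theorem label_map_iso:
  assumes "Y\<^sub>0 \<in> labelled_class pt Emp" and "fst \<mu> = 0"
  shows "classical_crystal_iso T (column_crystal T pt Y\<^sub>0 \<mu>) (perfect_crystal T) (label_map pt)"
proof -
  obtain k\<^sub>0 where Y0: "Y\<^sub>0 = col Emp k\<^sub>0" using assms(1) Emp_in by (auto simp: labelled_class_eq)
  note C = column_crystal_class[where k\<^sub>0 = k\<^sub>0 and \<mu> = \<mu>, folded Y0]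
  have P: "f_op (perfect_crystal T) i = next_f T i" "e_op (perfect_crystal T) i = next_e T i"
    "wt (perfect_crystal T) = vertex_wt T" if "i \<le> 4" for i
    using that by (simp_all add: perfect_crystal_def B_f_next_f B_e_next_e)
  show ?thesis
  proof (rule classical_crystal_iso_transport[OF perfect])
    show "bij_betw (label_map pt) (elems (column_crystal T pt Y\<^sub>0 \<mu>)) (elems (perfect_crystal T))"
      unfolding elems_column_crystal V
      by (rule bij_betw_byWitness[where f' = "labelled_class pt"]) (auto simp: label_map_labelled_class)
  next
    fix c assume "c \<in> elems (column_crystal T pt Y\<^sub>0 \<mu>)"
    then obtain v where v: "v \<in> set V" and c: "c = labelled_class pt v"
      by (auto simp: elems_column_crystal V)
    show "wt (perfect_crystal T) (label_map pt c) = wt (column_crystal T pt Y\<^sub>0 \<mu>) c"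
      using C(1)[OF v, of 0] P(3)[of 0] assms(2) by (simp add: c label_map_labelled_class v)
    fix i :: nat assume i: "i \<le> 4"
    note in_V = next_in[OF v i]
    show "e_op (perfect_crystal T) i (label_map pt c) = map_option (label_map pt) (e_op (column_crystal T pt Y\<^sub>0 \<mu>) i c)"
      using in_V by (cases "next_e T i v") (simp_all add: C(3)[OF v i] P[OF i] c label_map_labelled_class v)
    show "f_op (perfect_crystal T) i (label_map pt c) = map_option (label_map pt) (f_op (column_crystal T pt Y\<^sub>0 \<mu>) i c)"
      using in_V by (cases "next_f T i v") (simp_all add: C(2)[OF v i] P[OF i] c label_map_labelled_class v)
    show "eps (perfect_crystal T) i (label_map pt c) = eps (column_crystal T pt Y\<^sub>0 \<mu>) i c"
      "phi (perfect_crystal T) i (label_map pt c) = phi (column_crystal T pt Y\<^sub>0 \<mu>) i c"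
      by (simp_all add: C(4,5)[OF v i] c label_map_labelled_class v)
    fix c'
    show "e_op (column_crystal T pt Y\<^sub>0 \<mu>) i c = Some c' \<Longrightarrow> c' \<in> elems (column_crystal T pt Y\<^sub>0 \<mu>)"
      using in_V by (auto simp: C(3)[OF v i] c elems_column_crystal V)
    show "f_op (column_crystal T pt Y\<^sub>0 \<mu>) i c = Some c' \<Longrightarrow> c' \<in> elems (column_crystal T pt Y\<^sub>0 \<mu>)"
      using in_V by (auto simp: C(2)[OF v i] c elems_column_crystal V)
  qed
qed

lemma column_crystal_wt:
  assumes "Y\<^sub>0 \<in> labelled_class pt Emp" and "c \<in> elems (column_crystal T pt Y\<^sub>0 \<mu>)"
  shows "wt (column_crystal T pt Y\<^sub>0 \<mu>) c = wt (perfect_crystal T) (label_map pt c) + fst \<mu>"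
proof -
  obtain k\<^sub>0 where Y0: "Y\<^sub>0 = col Emp k\<^sub>0" using assms(1) Emp_in by (auto simp: labelled_class_eq)
  obtain v where v: "v \<in> set V" and c: "c = labelled_class pt v"
    using assms(2) by (auto simp: elems_column_crystal V)
  show ?thesis
    using column_crystal_class(1)[OF v, of 0 k\<^sub>0 \<mu>]
    by (simp add: Y0 c label_map_labelled_class v perfect_crystal_def add.commute)
qed

lemma labelled_class_label:
  assumes "v \<in> elems (perfect_crystal T)"
  shows "labelled_class pt v \<in> young_columns pt // column_rel pt" "label_map pt (labelled_class pt v) = v"
  using assms by (simp_all add: classes V label_map_labelled_class)

end

section \<open>The two patterns\<close>

text \<open>
  The blocks above the base form two (type \<open>E\<^sub>6\<^sup>(\<^sup>2\<^sup>)\<close>) or three (type \<open>F\<^sub>4\<^sup>(\<^sup>1\<^sup>)\<close>) chains; a column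
  of the table is a union of initial segments of these chains and is recorded by their lengths.
\<close>

definition table_list :: "'l \<Rightarrow> 'l list \<Rightarrow> 'l block list list \<Rightarrow> (vertex \<times> nat list) list \<Rightarrow> vertex \<Rightarrow> 'l block list"
  where "table_list q Q cs tab v = map (\<lambda>l. (l, 0)) (q # Q) @ concat (map2 take (the (map_of tab v)) cs)"

lemma table_labels:
  assumes tab: "table = (\<lambda>(v, hs). (v, set (concat (map2 take hs cs)))) ` set tab"
    and distinct: "distinct (map fst tab)"
    and D: "\<And>xs. cells H (map (\<lambda>l. (l, 0)) (q # Q) @ xs) = D \<union> set xs"
  shows "{(v, D \<union> S) | v S. (v, S) \<in> table} =
    (\<lambda>v. (v, cells H (table_list q Q cs tab v))) ` set (map fst tab)"
proof -
  have eq: "cells H (table_list q Q cs tab (fst x)) = D \<union> set (concat (map2 take (snd x) cs))"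
    if "x \<in> set tab" for x
    using map_of_is_SomeI[OF distinct, of "fst x" "snd x"] that unfolding table_list_def D by simp
  have "{(v, D \<union> S) | v S. (v, S) \<in> table} = (\<lambda>(v, S). (v, D \<union> S)) ` table"
    by (force simp: image_iff)
  also have "\<dots> = (\<lambda>x. (fst x, D \<union> set (concat (map2 take (snd x) cs)))) ` set tab"
    unfolding tab image_image by (rule image_cong) (simp_all add: case_prod_unfold)
  also have "\<dots> = (\<lambda>x. (fst x, cells H (table_list q Q cs tab (fst x)))) ` set tab"
    by (rule image_cong) (simp_all only: eq)
  finally show ?thesis by (simp add: image_image)
qed

lemma elems_perfect_crystal:
  "elems (perfect_crystal T) = set (map X (pos_list T) @ map (\<lambda>\<alpha>. X (- \<alpha>)) (pos_list T) @
     map R (case T of E62 \<Rightarrow> [1, 2] | F41 \<Rightarrow> [1, 2, 3, 4]) @ [Emp])"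
  unfolding perfect_crystal_def roots_def set_pos_list[symmetric] crystal.simps
  by (cases T) (simp_all only: aff_type.case set_append set_map list.set image_Un image_image Un_assoc)

lemma rests_step:
  assumes "pre_young pt Y" "(l, m) \<in> Y" "(c, k) \<in> support pt l" shows "(c, m + k) \<in> Y"
proof -
  have "(c, m + k) \<in> rests_on pt (l, m)" using assms(3) by (auto simp: rests_on_def)
  with assms(1,2) show ?thesis unfolding pre_young_def by blast
qed

section \<open>Evaluation for the first pattern\<close>

definition E_tab :: "(vertex \<times> nat list) list" where
  "E_tab = [
    (neg 1 2 1 0, [0,0]), (neg 1 2 1 1, [0,1]), (pos 1 1 1 1, [1,0]), (pos 1 1 1 0, [1,1]),
    (pos 0 1 1 1, [2,0]), (pos 0 1 1 0, [2,1]), (neg 1 2 2 1, [0,2]), (neg 1 3 2 1, [0,3]),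
    (neg 2 3 2 1, [0,4]), (Emp, [0,5]), (pos 1 1 0 0, [1,2]), (pos 1 0 0 0, [1,3]), (R 1, [1,4]),
    (pos 2 3 2 1, [1,5]), (pos 0 1 0 0, [2,2]), (neg 1 0 0 0, [2,4]), (pos 1 3 2 1, [2,5]),
    (R 2, [3,2]), (neg 0 1 0 0, [3,3]), (neg 1 1 0 0, [3,4]), (pos 1 2 2 1, [3,5]),
    (neg 0 1 1 0, [4,3]), (neg 1 1 1 0, [4,4]), (pos 1 2 1 1, [4,5]), (neg 0 1 1 1, [5,3]),
    (neg 1 1 1 1, [5,4]), (pos 1 2 1 0, [5,5])]"

definition E_chains :: "e_letter block list list" where
  "E_chains = [[(Ez, 0), (Ea, 1), (Eb', 1), (Ec', 1), (Ed, 1)],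
     [(Ed, 0), (Ec, 1), (Eb, 1), (Ea', 1), (Ez, 1)]]"

definition E_list :: "vertex \<Rightarrow> e_letter block list" where
  "E_list = table_list Eb'' [Ea', Ec'] E_chains E_tab"

text \<open>All blocks of index at most 0 together with \<open>Ea\<close>, \<open>Ec\<close>,
  \<open>Eb\<close> of index 1: the chain lengths 2 and 3, which are missing from
  \<open>E_tab\<close>.\<close>

definition E_exc :: "e_letter block list" where
  "E_exc = map (\<lambda>l. (l, 0)) (Eb'' # [Ea', Ec']) @ [(Ez, 0), (Ea, 1), (Ed, 0), (Ec, 1), (Eb, 1)]"

text \<open>Of these, \<open>Ez\<close> and \<open>Ed\<close> are absent from index 0 of
  \<open>E_D\<close>; the other three belong to \<open>E_D\<close> but are kept in the lists as
  frame and as the block resting on it.\<close>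

definition E_holes :: "e_letter list" where
  "E_holes = [Ez, Ed, Eb'', Ea', Ec']"

definition E_letters :: "e_letter list" where
  "E_letters = [Ez, Eb'', Ed, Ea', Ec', Eb, Eb', Ec, Ea]"

text \<open>Any block of index \<open>n\<close> forces \<open>Ec\<close> and \<open>Ea\<close> of
  index \<open>n - 1\<close> (\<open>next_row\<close>), and these two force the entire index below
  them (\<open>row\<close>).\<close>

lemma E_deep:
  assumes py: "pre_young E_pattern Y" and lm: "(l, m) \<in> Y"
  shows "(l', m - 2) \<in> Y \<and> (l', m - 3) \<in> Y"
proof -
  have z: "(c, n) \<in> Y" if "(l, n) \<in> Y" "(c, 0) \<in> E_support l" for l n c
    using rests_step[OF py that(1), of c 0] that(2) by (simp add: E_pattern_def)
  have o: "(c, n - 1) \<in> Y" if "(l, n) \<in> Y" "(c, - 1) \<in> E_support l" for l n c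
    using rests_step[OF py that(1), of c "- 1"] that(2) by (simp add: E_pattern_def)
  have bottom: "(Ec, n) \<in> Y \<and> (Ea, n) \<in> Y" if "(Ec', n) \<in> Y" for n
  proof -
    have "(Eb', n) \<in> Y" using z[OF that] by simp
    from z[OF this] show ?thesis by simp
  qed
  have next_row: "(Ec, n - 1) \<in> Y \<and> (Ea, n - 1) \<in> Y" if l: "(l, n) \<in> Y" for l n
  proof (cases "l = Ea")
    case True
    then have "(Eb'', n - 1) \<in> Y" using o[OF l] by simp
    then have "(Ec', n - 1) \<in> Y" using z by force
    then show ?thesis by (rule bottom)
  next
    case False
    have a': "(Ec, n) \<in> Y" if "(Ea', n) \<in> Y"
    proof -
      have "(Eb, n) \<in> Y" using z[OF that] by simp
      from z[OF this] show ?thesis by simp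
    qed
    have "(Ec, n) \<in> Y"
      using z[OF l] l False a' bottom[of n] by (cases l) auto
    then have "(Ed, n - 1) \<in> Y" using o by force
    then have "(Ec', n - 1) \<in> Y" using z by force
    then show ?thesis by (rule bottom)
  qed
  have row: "(l, n - 1) \<in> Y" if c: "(Ec, n) \<in> Y" and a: "(Ea, n) \<in> Y" for l n
  proof -
    have 1: "(Ez, n - 1) \<in> Y" "(Eb'', n - 1) \<in> Y" "(Ed, n - 1) \<in> Y" using o[OF c] o[OF a] by simp_all
    have 2: "(Ea', n - 1) \<in> Y" "(Ec', n - 1) \<in> Y" using z[OF 1(2)] by simp_all
    have 3: "(Eb, n - 1) \<in> Y" "(Eb', n - 1) \<in> Y" using z[OF 2(2)] by simp_all
    have 4: "(Ec, n - 1) \<in> Y" "(Ea, n - 1) \<in> Y" using z[OF 3(2)] by simp_all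
    from 1 2 3 4 show ?thesis by (cases l) simp_all
  qed
  have 2: "(l', m - 2) \<in> Y" for l' using next_row[OF lm] row[of "m - 1"] by simp
  then show ?thesis using row[of "m - 2"] by simp
qed

lemma E_labels:
  "labels E_pattern = (\<lambda>v. (v, cells E_holes (E_list v))) ` set (map fst E_tab)"
  unfolding E_pattern_def pattern.simps E_list_def
proof (rule table_labels)
  show "distinct (map fst E_tab)" by code_simp
  show "cells E_holes (map (\<lambda>l. (l, 0)) (Eb'' # [Ea', Ec']) @ xs) = E_D \<union> set xs" for xs
  proof -
    have "(l, m) \<in> cells E_holes (map (\<lambda>l. (l, 0)) (Eb'' # [Ea', Ec']) @ xs) \<longleftrightarrow> (l, m) \<in> E_D \<union> set xs" for l m
      by (cases l) (auto simp: cells_def occupied_def E_holes_def E_D_def)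
    then show ?thesis by auto
  qed
  show "E_table = (\<lambda>(v, hs). (v, set (concat (map2 take hs E_chains)))) ` set E_tab"
    by code_simp
qed

lemma E_vertices: "elems (perfect_crystal E62) = set (map fst E_tab)"
  unfolding elems_perfect_crystal by code_simp

lemma E_crystal: "\<forall>i\<in>set [0..<5]. \<forall>v\<in>set (map fst E_tab). crystal_at E62 (map fst E_tab) i v"
  by code_simp

lemma E_layout: "layout E_row E_support E_letters E_holes [Ea', Ec'] Eb''"
  by code_simp

lemma E_entries: "\<forall>v\<in>set (map fst E_tab).
    table_entry E_support E_letters E_holes [Ea', Ec'] Eb'' (E_list v) \<and> \<not> exceptional_list E_colour E_row E_support (E_list v)"
  by code_simp

lemma E_exc_entry:
  "table_entry E_support E_letters E_holes [Ea', Ec'] Eb'' E_exc \<and> exceptional_list E_colour E_row E_support E_exc"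
  by code_simp

lemma E_f_table: "\<forall>v\<in>set (map fst E_tab). \<forall>i\<in>set [0..<5].
    f_agrees E62 E_colour E_row E_support E_holes E_letters E_list i v"
  by code_simp

lemma E_e_table: "\<forall>v\<in>set (map fst E_tab). \<forall>i\<in>set [0..<5].
    e_agrees E62 E_colour E_row E_support E_holes E_letters E_list i v"
  by code_simp

lemma E_top_down: "top_down E_support (window E_letters)"
  by code_simp

lemma E_complete: "complete_table E_support E_letters
    (map (canonical_form E_holes E_letters) (E_exc # map E_list (map fst E_tab)))"
  by code_simp

lemma E_distinct: "distinct (map (canonical_form E_holes E_letters) (map E_list (map fst E_tab)))"
  by code_simp

definition E_walk2 :: "nat list" where
  "E_walk2 = [0, 1, 2, 3, 2, 1, 4, 3, 2, 2, 1, 3, 2, 4, 3, 2, 1, 0]"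

text \<open>Like \<open>E_walk2\<close> it descends from \<open>theta E62\<close> to its negative,
  but an inner 0-arrow leads from \<open>neg 1 1 0 0\<close> back up to
  \<open>pos 1 2 2 1\<close>.\<close>

definition E_walk3 :: "nat list" where
  "E_walk3 = [0, 1, 2, 3, 2, 1, 4, 3, 2, 2, 1, 0, 3, 2, 1, 4, 3, 2, 2, 1, 
    3, 2, 4, 3, 2, 1, 0]"

lemma E_walks:
  "walk E62 E_walk2 Emp = Some Emp" "count_list E_walk2 0 = 2"
  "walk E62 E_walk3 Emp = Some Emp" "count_list E_walk3 0 = 3"
  by code_simp+

lemma E_below_theta: "\<forall>v\<in>set (map fst E_tab). below_theta E62 v"
  by code_simp

interpretation E: column_table E_pattern E_colour E_row E_support E_letters E_holes "[Ea', Ec']" Eb''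
    E62 "map fst E_tab" E_list E_exc E_walk2 E_walk3
proof
  show "set E_letters = UNIV"
    unfolding E_letters_def by (auto intro: e_letter.exhaust)
qed (rule E_layout E_labels E_vertices E_crystal E_entries E_exc_entry E_f_table E_e_table E_top_down E_complete
    E_distinct E_walks E_below_theta | erule (1) E_deep | simp add: E_pattern_def)+

section \<open>Evaluation for the second pattern\<close>

definition F_tab :: "(vertex \<times> nat list) list" where
  "F_tab = [
    (neg 1 2 2 0, [0,0,0]), (neg 1 2 2 1, [0,1,0]), (neg 1 2 2 2, [0,1,1]),
    (pos 1 1 2 2, [1,0,0]), (pos 1 1 2 1, [1,1,0]), (pos 1 1 2 0, [1,1,1]),
    (pos 0 1 2 2, [2,0,0]), (pos 0 1 2 1, [2,1,0]), (pos 0 1 2 0, [2,1,1]),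
    (neg 1 2 3 1, [0,2,0]), (neg 1 2 3 2, [0,2,1]), (neg 1 2 4 2, [0,3,1]),
    (neg 1 3 4 2, [0,4,1]), (neg 2 3 4 2, [0,5,1]), (Emp, [0,6,1]), (pos 1 1 1 1, [1,2,0]),
    (pos 1 1 1 0, [1,2,1]), (pos 1 1 0 0, [1,3,1]), (pos 1 0 0 0, [1,4,1]), (R 1, [1,5,1]),
    (pos 2 3 4 2, [1,6,1]), (pos 0 1 1 1, [2,2,0]), (pos 0 1 1 0, [2,2,1]),
    (pos 0 1 0 0, [2,3,1]), (neg 1 0 0 0, [2,5,1]), (pos 1 3 4 2, [2,6,1]),
    (pos 0 0 1 1, [3,2,0]), (pos 0 0 1 0, [3,2,1]), (R 2, [3,3,1]), (neg 0 1 0 0, [3,4,1]),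
    (neg 1 1 0 0, [3,5,1]), (pos 1 2 4 2, [3,6,1]), (pos 0 0 0 1, [4,2,0]), (R 3, [4,2,1]),
    (neg 0 0 1 0, [4,3,1]), (neg 0 1 1 0, [4,4,1]), (neg 1 1 1 0, [4,5,1]),
    (pos 1 2 3 2, [4,6,1]), (R 4, [5,2,0]), (neg 0 0 0 1, [5,2,1]), (neg 0 0 1 1, [5,3,1]),
    (neg 0 1 1 1, [5,4,1]), (neg 1 1 1 1, [5,5,1]), (pos 1 2 3 1, [5,6,1]),
    (neg 0 1 2 0, [4,4,2]), (neg 1 1 2 0, [4,5,2]), (pos 1 2 2 2, [4,6,2]),
    (neg 0 1 2 1, [5,4,2]), (neg 1 1 2 1, [5,5,2]), (pos 1 2 2 1, [5,6,2]),
    (neg 0 1 2 2, [5,4,3]), (neg 1 1 2 2, [5,5,3]), (pos 1 2 2 0, [5,6,3])]"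

definition F_chains :: "f_letter block list list" where
  "F_chains = [[(Fz, 0), (Fa1, 1), (Fb1, 1), (Fc3, 1), (Fd2, 1)],
     [(Fd2, 0), (Fc1, 1), (Fc2, 1), (Fb2, 1), (Fa2, 1), (Fz, 1)],
     [(Fd1, 1), (Fc4, 1), (Fd1, 2)]]"

definition F_list :: "vertex \<Rightarrow> f_letter block list" where
  "F_list = table_list Fb3 [Fa2, Fc4] F_chains F_tab"

text \<open>The chain lengths 2, 4, 1, missing from \<open>F_tab\<close>.\<close>

definition F_exc :: "f_letter block list" where
  "F_exc = map (\<lambda>l. (l, 0)) (Fb3 # [Fa2, Fc4]) @ [(Fz, 0), (Fa1, 1), (Fd2, 0), (Fc1, 1), (Fc2, 1), (Fb2, 1), (Fd1, 1)]"

definition F_holes :: "f_letter list" where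
  "F_holes = [Fz, Fd2, Fb3, Fa2, Fc4]"

definition F_letters :: "f_letter list" where
  "F_letters = [Fz, Fb3, Fa2, Fc4, Fd2, Fb2, Fc3, Fc2, Fb1, Fc1, Fd1, Fa1]"

text \<open>As in \<open>E_deep\<close>, with \<open>Fc1\<close> and \<open>Fa1\<close> as the two
  blocks of index \<open>n - 1\<close> forced by any block of index \<open>n\<close>.\<close>

lemma F_deep:
  assumes py: "pre_young F_pattern Y" and lm: "(l, m) \<in> Y"
  shows "(l', m - 2) \<in> Y \<and> (l', m - 3) \<in> Y"
proof -
  have z: "(c, n) \<in> Y" if "(l, n) \<in> Y" "(c, 0) \<in> F_support l" for l n c
    using rests_step[OF py that(1), of c 0] that(2) by (simp add: F_pattern_def)
  have o: "(c, n - 1) \<in> Y" if "(l, n) \<in> Y" "(c, - 1) \<in> F_support l" for l n c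
    using rests_step[OF py that(1), of c "- 1"] that(2) by (simp add: F_pattern_def)
  have c3: "(Fb1, n) \<in> Y \<and> (Fc1, n) \<in> Y \<and> (Fa1, n) \<in> Y" if "(Fc3, n) \<in> Y" for n
  proof -
    have "(Fb1, n) \<in> Y" using z[OF that] by simp
    with z[OF this] show ?thesis by simp
  qed
  have b2: "(Fc2, n) \<in> Y \<and> (Fc1, n) \<in> Y \<and> (Fd1, n) \<in> Y" if "(Fb2, n) \<in> Y" for n
  proof -
    have "(Fc2, n) \<in> Y" using z[OF that] by simp
    with z[OF this] show ?thesis by simp
  qed
  have c4: "(Fc1, n) \<in> Y \<and> (Fa1, n) \<in> Y" if "(Fc4, n) \<in> Y" for n
    using c3[of n] z[OF that] by simp
  have next_row: "(Fc1, n - 1) \<in> Y \<and> (Fa1, n - 1) \<in> Y" if l: "(l, n) \<in> Y" for l n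
  proof (cases "l = Fa1 \<or> l = Fd1")
    case True
    then have "(Fb3, n - 1) \<in> Y \<or> (Fc4, n - 1) \<in> Y" using o[OF l] by auto
    then have "(Fc4, n - 1) \<in> Y" using z by force
    then show ?thesis by (rule c4)
  next
    case False
    have a2: "(Fc1, n) \<in> Y" if "(Fa2, n) \<in> Y" using b2[of n] z[OF that] by simp
    have "(Fc1, n) \<in> Y"
      using z[OF l] l False a2 b2[of n] c3[of n] by (cases l) auto
    then have "(Fc4, n - 1) \<in> Y" using o by force
    then show ?thesis by (rule c4)
  qed
  have row: "(l, n - 1) \<in> Y" if c: "(Fc1, n) \<in> Y" and a: "(Fa1, n) \<in> Y" for l n
  proof -
    have 1: "(Fz, n - 1) \<in> Y" "(Fb3, n - 1) \<in> Y" "(Fc4, n - 1) \<in> Y" "(Fd2, n - 1) \<in> Y"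
      using o[OF c] o[OF a] by simp_all
    have 2: "(Fa2, n - 1) \<in> Y" "(Fb2, n - 1) \<in> Y" "(Fc3, n - 1) \<in> Y"
      using z[OF 1(2)] z[OF 1(3)] by simp_all
    from 1 2 b2[OF 2(2)] c3[OF 2(3)] show ?thesis by (cases l) simp_all
  qed
  have 2: "(l', m - 2) \<in> Y" for l' using next_row[OF lm] row[of "m - 1"] by simp
  then show ?thesis using row[of "m - 2"] by simp
qed

lemma F_labels:
  "labels F_pattern = (\<lambda>v. (v, cells F_holes (F_list v))) ` set (map fst F_tab)"
  unfolding F_pattern_def pattern.simps F_list_def
proof (rule table_labels)
  show "distinct (map fst F_tab)" by code_simp
  show "cells F_holes (map (\<lambda>l. (l, 0)) (Fb3 # [Fa2, Fc4]) @ xs) = F_D \<union> set xs" for xs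
  proof -
    have "(l, m) \<in> cells F_holes (map (\<lambda>l. (l, 0)) (Fb3 # [Fa2, Fc4]) @ xs) \<longleftrightarrow> (l, m) \<in> F_D \<union> set xs" for l m
      by (cases l) (auto simp: cells_def occupied_def F_holes_def F_D_def)
    then show ?thesis by auto
  qed
  show "F_table = (\<lambda>(v, hs). (v, set (concat (map2 take hs F_chains)))) ` set F_tab"
    by code_simp
qed

lemma F_vertices: "elems (perfect_crystal F41) = set (map fst F_tab)"
  unfolding elems_perfect_crystal by code_simp

lemma F_crystal: "\<forall>i\<in>set [0..<5]. \<forall>v\<in>set (map fst F_tab). crystal_at F41 (map fst F_tab) i v"
  by code_simp

lemma F_layout: "layout F_row F_support F_letters F_holes [Fa2, Fc4] Fb3"
  by code_simp

lemma F_entries: "\<forall>v\<in>set (map fst F_tab).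
    table_entry F_support F_letters F_holes [Fa2, Fc4] Fb3 (F_list v) \<and> \<not> exceptional_list F_colour F_row F_support (F_list v)"
  by code_simp

lemma F_exc_entry:
  "table_entry F_support F_letters F_holes [Fa2, Fc4] Fb3 F_exc \<and> exceptional_list F_colour F_row F_support F_exc"
  by code_simp

lemma F_f_table: "\<forall>v\<in>set (map fst F_tab). \<forall>i\<in>set [0..<5].
    f_agrees F41 F_colour F_row F_support F_holes F_letters F_list i v"
  by code_simp

lemma F_e_table: "\<forall>v\<in>set (map fst F_tab). \<forall>i\<in>set [0..<5].
    e_agrees F41 F_colour F_row F_support F_holes F_letters F_list i v"
  by code_simp

lemma F_top_down: "top_down F_support (window F_letters)"
  by code_simp

lemma F_complete: "complete_table F_support F_letters
    (map (canonical_form F_holes F_letters) (F_exc # map F_list (map fst F_tab)))"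
  by code_simp

lemma F_distinct: "distinct (map (canonical_form F_holes F_letters) (map F_list (map fst F_tab)))"
  by code_simp

definition F_walk2 :: "nat list" where
  "F_walk2 = [0, 1, 2, 3, 3, 2, 1, 4, 3, 2, 3, 4, 4, 3, 2, 1, 3, 2, 3, 4, 
    3, 2, 1, 0]"

text \<open>The inner 0-arrow leads from \<open>neg 1 1 1 1\<close> to
  \<open>pos 1 2 3 1\<close>.\<close>

definition F_walk3 :: "nat list" where
  "F_walk3 = [0, 1, 2, 3, 3, 2, 1, 4, 3, 2, 3, 4, 4, 3, 2, 1, 0, 3, 2, 1, 
    3, 2, 3, 4, 4, 3, 2, 1, 3, 2, 3, 4, 3, 2, 1, 0]"

lemma F_walks:
  "walk F41 F_walk2 Emp = Some Emp" "count_list F_walk2 0 = 2"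
  "walk F41 F_walk3 Emp = Some Emp" "count_list F_walk3 0 = 3"
  by code_simp+

lemma F_below_theta: "\<forall>v\<in>set (map fst F_tab). below_theta F41 v"
  by code_simp

interpretation F: column_table F_pattern F_colour F_row F_support F_letters F_holes "[Fa2, Fc4]" Fb3
    F41 "map fst F_tab" F_list F_exc F_walk2 F_walk3
proof
  show "set F_letters = UNIV"
    unfolding F_letters_def by (auto intro: f_letter.exhaust)
qed (rule F_layout F_labels F_vertices F_crystal F_entries F_exc_entry F_f_table F_e_table F_top_down F_complete
    F_distinct F_walks F_below_theta | erule (1) F_deep | simp add: F_pattern_def)+

theorem proposition3p8:
  shows
    "(\<forall>Y\<^sub>0 \<in> labelled_class E_pattern Emp.
        classical_crystal_iso E62
          (column_crystal E62 E_pattern Y\<^sub>0 0) (perfect_crystal E62) (label_map E_pattern) \<and>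
        (\<forall>c \<in> elems (column_crystal E62 E_pattern Y\<^sub>0 (fund_weight 0)).
           wt (column_crystal E62 E_pattern Y\<^sub>0 (fund_weight 0)) c =
           wt (perfect_crystal E62) (label_map E_pattern c) + fst (fund_weight 0))) \<and>
     (\<forall>v \<in> elems (perfect_crystal E62).
        labelled_class E_pattern v \<in> young_columns E_pattern // column_rel E_pattern \<and>
        label_map E_pattern (labelled_class E_pattern v) = v) \<and>
     (\<forall>Y\<^sub>0 \<in> labelled_class F_pattern Emp.
        classical_crystal_iso F41
          (column_crystal F41 F_pattern Y\<^sub>0 0) (perfect_crystal F41) (label_map F_pattern) \<and>
        (\<forall>c \<in> elems (column_crystal F41 F_pattern Y\<^sub>0 (fund_weight 0)).
           wt (column_crystal F41 F_pattern Y\<^sub>0 (fund_weight 0)) c =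
           wt (perfect_crystal F41) (label_map F_pattern c) + fst (fund_weight 0))) \<and>
     (\<forall>v \<in> elems (perfect_crystal F41).
        labelled_class F_pattern v \<in> young_columns F_pattern // column_rel F_pattern \<and>
        label_map F_pattern (labelled_class F_pattern v) = v)"
  using E.label_map_iso E.column_crystal_wt E.labelled_class_label
    F.label_map_iso F.column_crystal_wt F.labelled_class_label by simp

end
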